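(* Let $q$ be an IDB relation in a datalog program $\Pi$, and let $\Pi'$ be the equivalent EDB-bounded datalog program constructed from $\Pi$ by the adornment algorithm (described in the context) with functions $g_{\mathsf{out}}$ and $h_{\mathsf{eq}}$. Then, for the evaluation of $\Pi$ on any database instance in which every EDB relation has at most $N$ tuples, $$|q|\le f(\Pi)\cdot N^{\mathsf{ew}(q)},$$ where $f(\Pi)$ is the number of IDB relations of the form $q_\rho$ in $\Pi'$ (i.e. the number of different adornments $\rho$ that $q$ takes in $\Pi'$) and $\mathsf{ew}(q)$ is the fractional edge-cover width of $q$.
   Context: Datalog. Standard positive datalog programs: finite sets of rules $q(\bar s)\gets p_1(\bar s_1),\dots,p_\mu(\bar s_\mu)$ whose terms are variables or constants. A predicate is IDB if it is the head predicate of a rule with non-empty body, otherwise EDB. "$\_$" denotes a fresh existentially quantified variable (each occurrence distinct). $|q|$ is the number of tuples in the relation $q$ in the least fixpoint of the program on the given EDB instance. Adorned predicates. For an IDB predicate $q$ and a safe rule $\rho$ (the adornment) with head predicate $q$ and only EDB atoms in the body, $q_\rho$ denotes a new predicate. Adornments are considered up to variable renaming. Adornment algorithm (parameters $g$, $h$). Start with $\Pi'=\emptyset$. Repeat until a fixpoint for $\Pi'$: for each rule $R: q(\bar s)\gets \bigwedge_{i=1}^{\lambda}p_i(\bar s_i)\wedge\mathcal E$ of $\Pi$ ($p_i$ IDB predicates, $\mathcal E$ a conjunction of EDB atoms, $\lambda\ge 0$), and for each choice $(\rho_1,\dots,\rho_\lambda)$ such that for each $i$ some rule of $\Pi'$ has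 head atom ${p_i}_{\rho_i}(\bar v_i)$: rename variables in these head atoms together with their adornments, obtaining ${p_i}_{\rho_i'}(\bar v_i')$, so that $R$ and all these head atoms are variable-disjoint; write $\rho_i'$ as $p_i(\bar v_i')\gets\mathcal B_i$; let $\sigma$ be a simultaneous most general unifier of $\{(\bar s_i,\bar v_i')\mid 1\le i\le\lambda\}$ (if none exists, skip this choice); let $\rho_0$ be the rule $q(\sigma(\bar s))\gets\bigwedge_{i}\sigma(\mathcal B_i)\wedge\sigma(\mathcal E)$, let $\rho=g(\rho_0)$, and let $R'$ be $q_\rho(\sigma(\bar s))\gets\bigwedge_i {p_i}_{\rho_i}(\sigma(\bar s_i))\wedge\sigma(\mathcal E)$; if $h(R',\Pi')$ is false, add $R'$ to $\Pi'$. Output $\Pi'$. $g_{\mathsf{out}}$: in each body atom, replace every argument that does not occur in the rule head by $\_$; then remove every body atom $e(\bar t)$ for which there is another body atom $e(\bar t')$ such that for each position $i$ either $t_i=t_i'$ or $t_i=\_$ (of identical atoms one is kept); in particular, atoms with only $\_$ arguments are removed. $h_{\mathsf{eq}}(R',\Pi')$ is true iff $\Pi'$ contains a rule identical to $R'$ up to variable renaming. Equivalent means that on every EDB instance the relation $q$ computed by $\Pi$ is the union over $\rho$ of the relations $q_\rho$ computed by $\Pi'$. EDB-bounded means that every tuple $\bar t$ such that $q_\rho(\bar t)$ is derived by a rule of $\Pi'$ with head predicate $q_\rho$ is also derived (as $q(\bar t)$) by the single rule $\rho$ on the same EDB. Edge-cover width. For an adornment $\rho: q(\bar s)\gets e_1(\bar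 t_1),\dots,e_\mu(\bar t_\mu)$, take the hypergraph with hyperedges $\mathsf{vars}(\bar t_i)$ on the body variables, and $V_{\mathsf{out}}=\mathsf{vars}(\bar s)$. The fractional edge-cover width $\mathsf{ew}(q_\rho)=\mathsf{ew}(\rho)$ is the minimum of $\sum_e x_e$ over assignments $0\le x_e\le 1$ to hyperedges with $\sum_{e\ni v}x_e\ge 1$ for all $v\in V_{\mathsf{out}}$. $\mathsf{ew}(q)$ is the maximum of $\mathsf{ew}(q_\rho)$ over all $q_\rho$ in $\Pi'$.
   Formalization: The formal theorem assumes N ≥ 1 or that no rule of Π has an empty body; for N = 0 with facts for IDB predicates the claim fails, e.g. q(a). q(x) ← e(x) on the empty database has |q| = 1 but bound 2·0 = 0. *)

theory Defs
  imports Complex_Main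
begin

section \<open>Datalog\<close>

datatype 'c trm = Var nat | Const 'c

type_synonym ('p, 'c) atom = "'p \<times> 'c trm list"

text \<open>A body is a conjunction, represented by its set of conjuncts.\<close>

datatype ('p, 'c) rule = Rule (hd_atom: "('p, 'c) atom") (body: "('p, 'c) atom set")

type_synonym ('p, 'c) program = "('p, 'c) rule set"

primrec vars_trm :: "'c trm \<Rightarrow> nat set" where
  "vars_trm (Var v) = {v}"
| "vars_trm (Const c) = {}"

definition vars_atom :: "('p, 'c) atom \<Rightarrow> nat set" where
  "vars_atom a = (\<Union>t \<in> set (snd a). vars_trm t)"

definition vars_rule :: "('p, 'c) rule \<Rightarrow> nat set" where
  "vars_rule R = vars_atom (hd_atom R) \<union> (\<Union>a \<in> body R. vars_atom a)"

definition safe :: "('p, 'c) rule \<Rightarrow> bool" where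
  "safe R \<longleftrightarrow> vars_atom (hd_atom R) \<subseteq> (\<Union>a \<in> body R. vars_atom a)"

definition datalog_program :: "('p \<Rightarrow> nat) \<Rightarrow> ('p, 'c) program \<Rightarrow> bool" where
  "datalog_program ar \<Pi> \<longleftrightarrow> finite \<Pi> \<and>
     (\<forall>R \<in> \<Pi>. finite (body R) \<and> safe R \<and>
       (\<forall>a \<in> insert (hd_atom R) (body R). length (snd a) = ar (fst a)))"

definition idb :: "('p, 'c) program \<Rightarrow> 'p set" where
  "idb \<Pi> = {fst (hd_atom R) | R. R \<in> \<Pi> \<and> body R \<noteq> {}}"

definition edb_instance :: "('p \<Rightarrow> nat) \<Rightarrow> ('p, 'c) program \<Rightarrow> ('p \<Rightarrow> 'c list set) \<Rightarrow> bool" where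
  "edb_instance ar \<Pi> D \<longleftrightarrow>
     (\<forall>p. finite (D p) \<and> (\<forall>t \<in> D p. length t = ar p)) \<and> (\<forall>p \<in> idb \<Pi>. D p = {})"

primrec eval_trm :: "(nat \<Rightarrow> 'c) \<Rightarrow> 'c trm \<Rightarrow> 'c" where
  "eval_trm \<theta> (Var v) = \<theta> v"
| "eval_trm \<theta> (Const c) = c"

inductive derivable :: "('p, 'c) program \<Rightarrow> ('p \<Rightarrow> 'c list set) \<Rightarrow> 'p \<Rightarrow> 'c list \<Rightarrow> bool"
  for \<Pi> D where
  from_edb: "t \<in> D p \<Longrightarrow> derivable \<Pi> D p t"
| from_rule: "R \<in> \<Pi> \<Longrightarrow>
    (\<And>a. a \<in> body R \<Longrightarrow> derivable \<Pi> D (fst a) (map (eval_trm \<theta>) (snd a))) \<Longrightarrow>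
    derivable \<Pi> D (fst (hd_atom R)) (map (eval_trm \<theta>) (snd (hd_atom R)))"

text \<open>
  The relation of a predicate in the least fixpoint. For an EDB predicate this is its
  relation in the instance, extended by those ground facts that the program itself may
  contain for it.
\<close>

definition rel :: "('p, 'c) program \<Rightarrow> ('p \<Rightarrow> 'c list set) \<Rightarrow> 'p \<Rightarrow> 'c list set" where
  "rel \<Pi> D p = {t. derivable \<Pi> D p t}"


section \<open>Substitutions, renaming and unification\<close>

primrec subst_trm :: "(nat \<Rightarrow> 'c trm) \<Rightarrow> 'c trm \<Rightarrow> 'c trm" where
  "subst_trm \<sigma> (Var v) = \<sigma> v"
| "subst_trm \<sigma> (Const c) = Const c"

definition subst_atom :: "(nat \<Rightarrow> 'c trm) \<Rightarrow> ('p, 'c) atom \<Rightarrow> ('p, 'c) atom" where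
  "subst_atom \<sigma> a = (fst a, map (subst_trm \<sigma>) (snd a))"

definition subst_rule :: "(nat \<Rightarrow> 'c trm) \<Rightarrow> ('p, 'c) rule \<Rightarrow> ('p, 'c) rule" where
  "subst_rule \<sigma> R = Rule (subst_atom \<sigma> (hd_atom R)) (subst_atom \<sigma> ` body R)"

definition variant :: "('p, 'c) rule \<Rightarrow> ('p, 'c) rule \<Rightarrow> bool" where
  "variant R S \<longleftrightarrow> (\<exists>\<pi>. bij \<pi> \<and> S = subst_rule (\<lambda>v. Var (\<pi> v)) R)"

definition unifier :: "(nat \<Rightarrow> 'c trm) \<Rightarrow> ('c trm list \<times> 'c trm list) set \<Rightarrow> bool" where
  "unifier \<sigma> U \<longleftrightarrow> (\<forall>(s, t) \<in> U. map (subst_trm \<sigma>) s = map (subst_trm \<sigma>) t)"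

definition mgu :: "(nat \<Rightarrow> 'c trm) \<Rightarrow> ('c trm list \<times> 'c trm list) set \<Rightarrow> bool" where
  "mgu \<sigma> U \<longleftrightarrow> unifier \<sigma> U \<and>
     (\<forall>\<tau>. unifier \<tau> U \<longrightarrow> (\<exists>\<delta>. \<forall>v. \<tau> v = subst_trm \<delta> (\<sigma> v)))"


section \<open>Adorned predicates and the adornment algorithm\<close>

text \<open>
  Adornments are taken up to variable renaming, so an adorned predicate $q_\rho$ carries
  the class of all variants of $\rho$.
\<close>

datatype ('p, 'c) apred = Edb 'p | Adorned 'p "('p, 'c) rule set"

definition adorned :: "'p \<Rightarrow> ('p, 'c) rule \<Rightarrow> ('p, 'c) apred" where
  "adorned q \<rho> = Adorned q {\<rho>'. variant \<rho> \<rho>'}"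

type_synonym ('p, 'c) aprogram = "(('p, 'c) apred, 'c) program"

definition idb_atoms :: "('p, 'c) program \<Rightarrow> ('p, 'c) rule \<Rightarrow> ('p, 'c) atom set" where
  "idb_atoms \<Pi> R = {a \<in> body R. fst a \<in> idb \<Pi>}"

definition edb_atoms :: "('p, 'c) program \<Rightarrow> ('p, 'c) rule \<Rightarrow> ('p, 'c) atom set" where
  "edb_atoms \<Pi> R = {a \<in> body R. fst a \<notin> idb \<Pi>}"

text \<open>
  \<open>candidate g \<Pi> P R'\<close>: the rule \<open>R'\<close> arises from a rule \<open>R\<close> of \<open>\<Pi>\<close> and a choice of adorned
  predicates that are head predicates in \<open>P\<close>. The function \<open>\<rho>s\<close> gives, for each IDB
  atom of \<open>R\<close>, the renamed adornment $\rho_i'$. Its head $p_i(\bar v_i')$ at the same time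
  supplies the arguments of the renamed head atom: a rule for $q_\rho$ has the same head
  arguments as $\rho$, so renaming such a head atom together with its adornment amounts to
  choosing a variant of $\rho$. Not only the head variables of the $\rho_i'$ are kept apart,
  but also their remaining ones, which stand for anonymous variables.

  The parameter \<open>g\<close> is a relation, since its result is only determined up to the names of
  the anonymous variables.
\<close>

definition candidate ::
  "(('p, 'c) rule \<Rightarrow> ('p, 'c) rule \<Rightarrow> bool) \<Rightarrow> ('p, 'c) program \<Rightarrow> ('p, 'c) aprogram
     \<Rightarrow> (('p, 'c) apred, 'c) rule \<Rightarrow> bool" where
  "candidate g \<Pi> P R' \<longleftrightarrow> (\<exists>R \<in> \<Pi>. \<exists>\<rho>s \<sigma> \<rho>.
     (\<forall>a \<in> idb_atoms \<Pi> R.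
        fst (hd_atom (\<rho>s a)) = fst a \<and>
        (\<exists>S \<in> P. fst (hd_atom S) = adorned (fst a) (\<rho>s a)) \<and>
        vars_rule (\<rho>s a) \<inter> vars_rule R = {}) \<and>
     (\<forall>a \<in> idb_atoms \<Pi> R. \<forall>b \<in> idb_atoms \<Pi> R. a \<noteq> b \<longrightarrow>
        vars_rule (\<rho>s a) \<inter> vars_rule (\<rho>s b) = {}) \<and>
     mgu \<sigma> ((\<lambda>a. (snd a, snd (hd_atom (\<rho>s a)))) ` idb_atoms \<Pi> R) \<and>
     g (Rule (subst_atom \<sigma> (hd_atom R))
          ((\<Union>a \<in> idb_atoms \<Pi> R. subst_atom \<sigma> ` body (\<rho>s a))
             \<union> subst_atom \<sigma> ` edb_atoms \<Pi> R)) \<rho> \<and>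
     R' = Rule
       (adorned (fst (hd_atom R)) \<rho>, map (subst_trm \<sigma>) (snd (hd_atom R)))
       ((\<lambda>a. (adorned (fst a) (\<rho>s a), map (subst_trm \<sigma>) (snd a))) ` idb_atoms \<Pi> R
          \<union> (\<lambda>a. (Edb (fst a), map (subst_trm \<sigma>) (snd a))) ` edb_atoms \<Pi> R))"

definition adorn_step ::
  "(('p, 'c) rule \<Rightarrow> ('p, 'c) rule \<Rightarrow> bool) \<Rightarrow>
   ((('p, 'c) apred, 'c) rule \<Rightarrow> ('p, 'c) aprogram \<Rightarrow> bool) \<Rightarrow>
   ('p, 'c) program \<Rightarrow> ('p, 'c) aprogram \<Rightarrow> ('p, 'c) aprogram \<Rightarrow> bool" where
  "adorn_step g h \<Pi> P P' \<longleftrightarrow> (\<exists>R'. candidate g \<Pi> P R' \<and> \<not> h R' P \<and> P' = insert R' P)"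

definition adornment_output ::
  "(('p, 'c) rule \<Rightarrow> ('p, 'c) rule \<Rightarrow> bool) \<Rightarrow>
   ((('p, 'c) apred, 'c) rule \<Rightarrow> ('p, 'c) aprogram \<Rightarrow> bool) \<Rightarrow>
   ('p, 'c) program \<Rightarrow> ('p, 'c) aprogram \<Rightarrow> bool" where
  "adornment_output g h \<Pi> P \<longleftrightarrow>
     (adorn_step g h \<Pi>)\<^sup>*\<^sup>* {} P \<and> \<not> (\<exists>P'. adorn_step g h \<Pi> P P')"

text \<open>
  For $g_{\mathsf{out}}$, atoms are first masked: \<open>None\<close> is the anonymous variable \<open>_\<close>.
\<close>

type_synonym ('p, 'c) masked_atom = "'p \<times> 'c trm option list"

definition mask :: "'c trm set \<Rightarrow> ('p, 'c) atom \<Rightarrow> ('p, 'c) masked_atom" where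
  "mask H a = (fst a, map (\<lambda>t. if t \<in> H then Some t else None) (snd a))"

definition subsumed :: "('p, 'c) masked_atom \<Rightarrow> ('p, 'c) masked_atom \<Rightarrow> bool" where
  "subsumed a b \<longleftrightarrow> fst a = fst b \<and> list_all2 (\<lambda>t t'. t = t' \<or> t = None) (snd a) (snd b)"

text \<open>
  On masked atoms, \<open>subsumed\<close> is a partial order, so removing all subsumed atoms at once
  agrees with removing them one after the other.
\<close>

definition irredundant :: "('p, 'c) masked_atom set \<Rightarrow> ('p, 'c) masked_atom set" where
  "irredundant B = {a \<in> B. \<not> (\<forall>t \<in> set (snd a). t = None) \<and> \<not> (\<exists>b \<in> B. b \<noteq> a \<and> subsumed a b)}"

text \<open>The \<open>i\<close>-th argument of \<open>a\<close>, if anonymous, is turned into the variable \<open>\<nu> (a, i)\<close>.\<close>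

definition unmask :: "(('p, 'c) masked_atom \<times> nat \<Rightarrow> nat) \<Rightarrow> ('p, 'c) masked_atom \<Rightarrow> ('p, 'c) atom" where
  "unmask \<nu> a = (fst a,
     map (\<lambda>i. case snd a ! i of Some t \<Rightarrow> t | None \<Rightarrow> Var (\<nu> (a, i))) [0..<length (snd a)])"

definition g_out :: "('p, 'c) rule \<Rightarrow> ('p, 'c) rule \<Rightarrow> bool" where
  "g_out \<rho>0 \<rho> \<longleftrightarrow>
     (let B = irredundant (mask (set (snd (hd_atom \<rho>0))) ` body \<rho>0);
          occs = (SIGMA a:B. {..<length (snd a)})
      in \<exists>\<nu>. inj_on \<nu> occs \<and> \<nu> ` occs \<inter> vars_atom (hd_atom \<rho>0) = {} \<and>
             \<rho> = Rule (hd_atom \<rho>0) (unmask \<nu> ` B))"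

definition h_eq :: "('p, 'c) rule \<Rightarrow> ('p, 'c) program \<Rightarrow> bool" where
  "h_eq R P \<longleftrightarrow> (\<exists>S \<in> P. variant R S)"


section \<open>Fractional edge-cover width\<close>

definition hyperedges :: "('p, 'c) rule \<Rightarrow> nat set set" where
  "hyperedges \<rho> = vars_atom ` body \<rho>"

definition fractional_cover :: "('p, 'c) rule \<Rightarrow> (nat set \<Rightarrow> real) \<Rightarrow> bool" where
  "fractional_cover \<rho> x \<longleftrightarrow>
     (\<forall>e \<in> hyperedges \<rho>. 0 \<le> x e \<and> x e \<le> 1) \<and>
     (\<forall>v \<in> vars_atom (hd_atom \<rho>). 1 \<le> (\<Sum>e \<in> {e \<in> hyperedges \<rho>. v \<in> e}. x e))"

text \<open>
  For a safe rule with finite body the infimum is a minimum, as the feasible region is a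
  non-empty compact polytope.
\<close>

definition ew_rule :: "('p, 'c) rule \<Rightarrow> real" where
  "ew_rule \<rho> = Inf {\<Sum>e \<in> hyperedges \<rho>. x e | x. fractional_cover \<rho> x}"

definition adorned_preds :: "'p \<Rightarrow> ('p, 'c) aprogram \<Rightarrow> ('p, 'c) apred set" where
  "adorned_preds q P = {fst (hd_atom S) | S. S \<in> P} \<inter> range (adorned q)"

text \<open>All representatives of an adornment have the same width.\<close>

definition ew :: "'p \<Rightarrow> ('p, 'c) aprogram \<Rightarrow> real" where
  "ew q P = Max {ew_rule \<rho> | \<rho>. adorned q \<rho> \<in> adorned_preds q P}"

end

theory Submission
  imports Defs
begin

text \<open>
  By induction on derivations, each tuple of an IDB relation is already an answer of one of its
  adornments alone: the adornments that derive the IDB atoms of a rule, together with the rule,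
  merge under a most general unifier into a rule over EDB atoms, masking only weakens its body,
  and at the fixpoint the result occurs in the output. So \<open>q\<close> is covered by the answers of its
  adornments, and each of these sets is bounded by the projected version of the bound of Atserias,
  Grohe and Marx.
\<close>

section \<open>The edge-cover bound\<close>

text \<open>The width asks only for a cover of the head variables, while bodies also carry
  existential ones; hence the bound concerns projections of the set of satisfying valuations rather
  than that set itself. Answers of an adornment are taken over \<open>rel \<Pi> D\<close> and not
  over \<open>D\<close>, because a program may state ground facts for an EDB predicate, and these
  count towards \<open>N\<close>. An adorned predicate stores a class of variants, so answers, width
  and invariants of adornments must not depend on the representative. Two conventions shape the last
  estimates: \<open>ew_rule\<close> is an infimum, reached through logarithms from the bound for
  each single cover, and \<open>0 powr y = 0\<close>, so that for \<open>N = 0\<close> the relation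
  itself has to be shown empty.\<close>

lemma weighted_arith_geom_mean:
  fixes w c :: "'a \<Rightarrow> real"
  assumes "finite S" "\<And>i. i \<in> S \<Longrightarrow> 0 \<le> w i" "sum w S = 1" "\<And>i. i \<in> S \<Longrightarrow> 0 < c i"
  shows "(\<Prod>i\<in>S. c i powr w i) \<le> (\<Sum>i\<in>S. w i * c i)"
proof -
  define M where "M = (\<Sum>i\<in>S. w i * c i)"
  obtain j where "j \<in> S" "0 < w j"
    using assms(2,3) by (metis less_eq_real_def sum.neutral zero_neq_one)
  then have M: "0 < M"
    unfolding M_def using assms by (intro sum_pos2[of _ j]) (auto simp: less_imp_le)
  have "(\<Sum>i\<in>S. w i * ln (c i)) - ln M = (\<Sum>i\<in>S. w i * ln (c i / M))"
  proof -
    have "w i * ln (c i / M) = w i * ln (c i) - w i * ln M" if "i \<in> S" for i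
      using assms(4)[OF that] M by (simp add: ln_div right_diff_distrib)
    then show ?thesis
      using assms(3) by (simp add: sum_subtractf sum_distrib_right[symmetric])
  qed
  \<comment> \<open>The tangent inequality \<open>ln y \<le> y - 1\<close> is applied at
    \<open>y = c i / M\<close>; dividing by the mean \<open>M\<close> makes the right-hand side sum
    to 0.\<close>
  also have "\<dots> \<le> (\<Sum>i\<in>S. w i * (c i / M - 1))"
    using assms(2,4) M by (intro sum_mono mult_left_mono ln_le_minus_one) auto
  also have "\<dots> = M / M - 1"
    using assms(3) by (simp add: right_diff_distrib sum_subtractf sum_divide_distrib[symmetric] M_def[symmetric])
  finally have "(\<Sum>i\<in>S. w i * ln (c i)) \<le> ln M"
    using M by simp
  moreover have "(\<Prod>i\<in>S. c i powr w i) = exp (\<Sum>i\<in>S. w i * ln (c i))"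
    using assms(1,4) by (auto simp: exp_sum powr_def less_le intro!: prod.cong)
  ultimately show ?thesis
    using M by (simp add: M_def[symmetric] ln_ge_iff)
qed

text \<open>Dividing each \<open>b a e\<close> by its total over \<open>I\<close> gives quotients of
  at most 1. The weighted mean inequality bounds their product by a convex combination, and summing
  that combination over \<open>I\<close> gives exactly 1.\<close>

lemma generalized_Hoelder:
  fixes b :: "'a \<Rightarrow> 'b \<Rightarrow> real" and x :: "'b \<Rightarrow> real"
  assumes "finite I" "finite E" "\<And>e. e \<in> E \<Longrightarrow> 0 \<le> x e" "1 \<le> sum x E"
    and pos: "\<And>a e. a \<in> I \<Longrightarrow> e \<in> E \<Longrightarrow> 0 < b a e"
  shows "(\<Sum>a\<in>I. \<Prod>e\<in>E. b a e powr x e) \<le> (\<Prod>e\<in>E. (\<Sum>a\<in>I. b a e) powr x e)"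
proof (cases "I = {}")
  case True
  then show ?thesis by (simp add: prod_nonneg)
next
  case False
  define S where "S e = (\<Sum>a\<in>I. b a e)" for e
  define s where "s = sum x E"
  have S_pos: "0 < S e" if "e \<in> E" for e
    unfolding S_def using assms(1) False pos that by (intro sum_pos) auto
  have le_S: "b a e \<le> S e" if "a \<in> I" "e \<in> E" for a e
    unfolding S_def using assms(1) that pos by (intro member_le_sum) (auto intro: less_imp_le)
  have term_le: "(\<Prod>e\<in>E. b a e powr x e) \<le> (\<Prod>e\<in>E. S e powr x e) * (\<Sum>e\<in>E. x e / s * (b a e / S e))"
    if a: "a \<in> I" for a
  proof -
    have "(\<Prod>e\<in>E. b a e powr x e) = (\<Prod>e\<in>E. S e powr x e) * (\<Prod>e\<in>E. (b a e / S e) powr x e)"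
      unfolding prod.distrib[symmetric]
      using S_pos pos[OF a] by (intro prod.cong) (auto simp: powr_divide less_imp_le less_imp_neq[symmetric])
    \<comment> \<open>The quotients are at most 1 and \<open>s\<close> is at least 1, so scaling the
      exponents down to weights of sum 1 cannot decrease the powers.\<close>
    also have "(\<Prod>e\<in>E. (b a e / S e) powr x e) \<le> (\<Prod>e\<in>E. (b a e / S e) powr (x e / s))"
    proof (intro prod_mono conjI powr_mono')
      fix e assume e: "e \<in> E"
      show "x e / s \<le> x e"
        using assms(4) mult_left_mono[OF assms(4) assms(3)[OF e]] by (simp add: s_def divide_le_eq)
      show "0 \<le> b a e / S e" "b a e / S e \<le> 1"
        using S_pos[OF e] pos[OF a e] le_S[OF a e] by auto
    qed auto
    also have "\<dots> \<le> (\<Sum>e\<in>E. x e / s * (b a e / S e))"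
      using assms S_pos pos[OF a]
      by (intro weighted_arith_geom_mean) (auto simp: s_def sum_divide_distrib[symmetric])
    finally show ?thesis
      by (simp add: mult_left_mono prod_nonneg)
  qed
  have "(\<Sum>a\<in>I. \<Prod>e\<in>E. b a e powr x e)
      \<le> (\<Sum>a\<in>I. (\<Prod>e\<in>E. S e powr x e) * (\<Sum>e\<in>E. x e / s * (b a e / S e)))"
    using term_le by (rule sum_mono)
  also have "\<dots> = (\<Prod>e\<in>E. S e powr x e) * (\<Sum>e\<in>E. \<Sum>a\<in>I. x e / s * (b a e / S e))"
    by (subst sum.swap) (simp add: sum_distrib_left)
  also have "(\<Sum>e\<in>E. \<Sum>a\<in>I. x e / s * (b a e / S e)) = (\<Sum>e\<in>E. x e / s * (S e / S e))"
    unfolding sum_distrib_left[symmetric] sum_divide_distrib[symmetric] by (simp only: S_def)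
  also have "\<dots> = (\<Sum>e\<in>E. x e / s)"
    using S_pos by (intro sum.cong) (auto simp: less_imp_neq[symmetric])
  also have "\<dots> = 1"
    using assms(4) by (simp add: s_def sum_divide_distrib[symmetric])
  finally show ?thesis by (simp add: S_def)
qed

text \<open>A partial valuation is a total function with the fixed value \<open>undefined\<close>
  outside its domain, so that equality of restrictions means agreement on \<open>W\<close> and
  projections to different sets share one type.\<close>

definition restrict :: "('a \<Rightarrow> 'b) \<Rightarrow> 'a set \<Rightarrow> 'a \<Rightarrow> 'b" where
  "restrict \<theta> W = (\<lambda>v. if v \<in> W then \<theta> v else undefined)"

definition proj :: "'a set \<Rightarrow> ('a \<Rightarrow> 'b) set \<Rightarrow> ('a \<Rightarrow> 'b) set" where
  "proj W A = (\<lambda>\<theta>. restrict \<theta> W) ` A"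

lemma finite_proj: "finite A \<Longrightarrow> finite (proj W A)"
  by (simp add: proj_def)

lemma card_proj_insert:
  assumes "finite A"
  shows "card (proj (insert v W) A) = (\<Sum>a\<in>(\<lambda>\<theta>. \<theta> v) ` A. card (proj W {\<theta> \<in> A. \<theta> v = a}))"
proof -
  let ?A = "\<lambda>a. {\<theta> \<in> A. \<theta> v = a}"
  have "proj (insert v W) A = (\<Union>a\<in>(\<lambda>\<theta>. \<theta> v) ` A. proj (insert v W) (?A a))"
    by (auto simp: proj_def)
  also have "card \<dots> = (\<Sum>a\<in>(\<lambda>\<theta>. \<theta> v) ` A. card (proj (insert v W) (?A a)))"
  proof (rule card_UN_disjoint)
    show "\<forall>i\<in>(\<lambda>\<theta>. \<theta> v) ` A. \<forall>j\<in>(\<lambda>\<theta>. \<theta> v) ` A. i \<noteq> j \<longrightarrow>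
        proj (insert v W) (?A i) \<inter> proj (insert v W) (?A j) = {}"
      by (auto simp: proj_def restrict_def dest: fun_cong[of _ _ v])
  qed (use assms in \<open>auto simp: proj_def\<close>)
  also have "\<dots> = (\<Sum>a\<in>(\<lambda>\<theta>. \<theta> v) ` A. card (proj W (?A a)))"
  proof (rule sum.cong[OF refl])
    fix a
    \<comment> \<open>Inside one fibre the value at \<open>v\<close> is the constant
      \<open>a\<close>, so adding \<open>v\<close> to the domain loses and gains nothing; this also
      holds if \<open>v\<close> already lies in \<open>W\<close>.\<close>
    have eq: "restrict \<theta> (insert v W) = (restrict \<theta> W)(v := a)" if "\<theta> v = a" for \<theta> :: "'a \<Rightarrow> 'b"
      using that by (auto simp: fun_eq_iff restrict_def)
    have "restrict \<theta> W = restrict \<theta>' W"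
      if "\<theta> v = a" "\<theta>' v = a" "(restrict \<theta> W)(v := a) = (restrict \<theta>' W)(v := a)" for \<theta> \<theta>' :: "'a \<Rightarrow> 'b"
      using that by (auto simp: fun_eq_iff restrict_def split: if_splits)
    then have "inj_on (\<lambda>f. f(v := a)) (proj W (?A a))"
      by (auto simp: inj_on_def proj_def)
    moreover have "proj (insert v W) (?A a) = (\<lambda>f. f(v := a)) ` proj W (?A a)"
      unfolding proj_def image_image by (intro image_cong refl) (simp add: eq)
    ultimately show "card (proj (insert v W) (?A a)) = card (proj W (?A a))"
      by (simp add: card_image)
  qed
  finally show ?thesis .
qed

text \<open>
  The bound of Atserias, Grohe and Marx with projection to \<open>V\<close>. Splitting \<open>A\<close> by the value of one
  variable reduces \<open>V\<close> by that variable; the pieces are recombined by Hoelder's inequality, whose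
  exponents sum to at least 1 because the variable is covered.
\<close>

theorem card_proj_le_prod:
  fixes x :: "'a set \<Rightarrow> real"
  assumes "finite V" "finite A" and E: "finite E" "\<And>e. e \<in> E \<Longrightarrow> 0 \<le> x e"
    and "\<And>v. v \<in> V \<Longrightarrow> 1 \<le> (\<Sum>e \<in> {e \<in> E. v \<in> e}. x e)"
  shows "real (card (proj V A)) \<le> (\<Prod>e\<in>E. real (card (proj (e \<inter> V) A)) powr x e)"
  using assms(1,2,5)
proof (induction V arbitrary: A)
  case empty
  show ?case
  proof (cases "A = {}")
    \<comment> \<open>Every factor on the right is 1 here, since each \<open>e\<close> meets the
      empty set in the empty set.\<close>
    case False
    then have "proj {} A = {\<lambda>_. undefined}"
      unfolding proj_def restrict_def by auto
    then show ?thesis by simp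
  qed (simp add: proj_def prod_nonneg)
next
  case (insert v V)
  let ?C = "(\<lambda>\<theta>. \<theta> v) ` A" and ?A = "\<lambda>a. {\<theta> \<in> A. \<theta> v = a}"
  define E1 where "E1 = {e \<in> E. v \<in> e}"
  define E2 where "E2 = {e \<in> E. v \<notin> e}"
  have E12: "E = E1 \<union> E2" "E1 \<inter> E2 = {}" "finite E1" "finite E2"
    using E by (auto simp: E1_def E2_def)
  have split: "prod f E = prod f E1 * prod f E2" for f :: "'a set \<Rightarrow> real"
    unfolding E12(1) using E12 by (intro prod.union_disjoint) auto
  let ?b = "\<lambda>a e. real (card (proj (e \<inter> V) (?A a)))"
  let ?P = "\<Prod>e\<in>E2. real (card (proj (e \<inter> insert v V) A)) powr x e"
  have "real (card (proj (insert v V) A)) = (\<Sum>a\<in>?C. real (card (proj V (?A a))))"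
    using insert.prems(1) by (simp add: card_proj_insert)
  also have "\<dots> \<le> (\<Sum>a\<in>?C. \<Prod>e\<in>E. ?b a e powr x e)"
    using insert.prems by (intro sum_mono insert.IH) auto
  \<comment> \<open>Edges without \<open>v\<close> are bounded uniformly in \<open>a\<close> by
    their projections of all of \<open>A\<close>, so that they leave the sum as the constant factor
    \<open>?P\<close>. Only the edges through \<open>v\<close> enter Hoelder's inequality.\<close>
  also have "\<dots> \<le> (\<Sum>a\<in>?C. (\<Prod>e\<in>E1. ?b a e powr x e) * ?P)"
    unfolding split
  proof (intro sum_mono mult_left_mono prod_mono conjI powr_mono2)
    fix a e assume "e \<in> E2"
    then have "e \<inter> insert v V = e \<inter> V" by (auto simp: E2_def)
    then show "?b a e \<le> real (card (proj (e \<inter> insert v V) A))"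
      using insert.prems(1) by (auto simp: proj_def intro!: card_mono)
  qed (use E E12 in \<open>auto simp: prod_nonneg\<close>)
  also have "\<dots> = (\<Sum>a\<in>?C. \<Prod>e\<in>E1. ?b a e powr x e) * ?P"
    by (simp add: sum_distrib_right)
  also have "\<dots> \<le> (\<Prod>e\<in>E1. (\<Sum>a\<in>?C. ?b a e) powr x e) * ?P"
  proof (intro mult_right_mono generalized_Hoelder)
    show "1 \<le> sum x E1" unfolding E1_def by (rule insert.prems(2)) simp
    \<comment> \<open>The sum ranges over attained values only, so no piece is empty.\<close>
    show "0 < ?b a e" if "a \<in> ?C" for a e
      using that insert.prems(1) by (auto simp: proj_def card_gt_0_iff)
  qed (use E E12 insert.prems(1) in \<open>auto simp: prod_nonneg\<close>)
  also have "(\<Prod>e\<in>E1. (\<Sum>a\<in>?C. ?b a e) powr x e)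
      = (\<Prod>e\<in>E1. real (card (proj (e \<inter> insert v V) A)) powr x e)"
  proof (rule prod.cong[OF refl])
    fix e assume "e \<in> E1"
    then have "e \<inter> insert v V = insert v (e \<inter> V)" by (auto simp: E1_def)
    then show "(\<Sum>a\<in>?C. ?b a e) powr x e = real (card (proj (e \<inter> insert v V) A)) powr x e"
      using insert.prems(1) by (simp add: card_proj_insert)
  qed
  finally show ?case by (simp add: split)
qed

section \<open>Substitutions and variants\<close>

lemma subst_trm_Var [simp]: "subst_trm Var t = t"
  by (cases t) auto

lemma subst_trm_subst_trm: "subst_trm \<tau> (subst_trm \<sigma> t) = subst_trm (\<lambda>v. subst_trm \<tau> (\<sigma> v)) t"
  by (cases t) auto

lemma eval_trm_subst_trm: "eval_trm \<theta> (subst_trm \<sigma> t) = eval_trm (\<lambda>v. eval_trm \<theta> (\<sigma> v)) t"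
  by (cases t) auto

lemma eval_trm_cong: "(\<And>v. v \<in> vars_trm t \<Longrightarrow> \<theta> v = \<theta>' v) \<Longrightarrow> eval_trm \<theta> t = eval_trm \<theta>' t"
  by (cases t) auto

lemma map_eval_trm_cong:
  "(\<And>v. v \<in> vars_atom a \<Longrightarrow> \<theta> v = \<theta>' v) \<Longrightarrow> map (eval_trm \<theta>) (snd a) = map (eval_trm \<theta>') (snd a)"
  by (auto simp: vars_atom_def intro: eval_trm_cong)

lemma in_vars_trm_iff: "v \<in> vars_trm t \<longleftrightarrow> t = Var v"
  by (cases t) auto

lemma in_vars_atom_iff: "v \<in> vars_atom a \<longleftrightarrow> Var v \<in> set (snd a)"
  by (auto simp: vars_atom_def in_vars_trm_iff)

lemma finite_vars_trm [simp]: "finite (vars_trm t)"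
  by (cases t) auto

lemma finite_vars_atom [simp]: "finite (vars_atom a)"
  by (simp add: vars_atom_def)

lemma finite_vars_rule: "finite (body R) \<Longrightarrow> finite (vars_rule R)"
  by (simp add: vars_rule_def)

lemma vars_trm_subst: "vars_trm (subst_trm \<sigma> t) = (\<Union>v\<in>vars_trm t. vars_trm (\<sigma> v))"
  by (cases t) auto

lemma vars_atom_subst: "vars_atom (subst_atom \<sigma> a) = (\<Union>v\<in>vars_atom a. vars_trm (\<sigma> v))"
  by (auto simp: vars_atom_def subst_atom_def vars_trm_subst)

lemma fst_subst_atom [simp]: "fst (subst_atom \<sigma> a) = fst a"
  and snd_subst_atom [simp]: "snd (subst_atom \<sigma> a) = map (subst_trm \<sigma>) (snd a)"
  by (simp_all add: subst_atom_def)

lemma hd_atom_subst_rule [simp]: "hd_atom (subst_rule \<sigma> R) = subst_atom \<sigma> (hd_atom R)"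
  and body_subst_rule [simp]: "body (subst_rule \<sigma> R) = subst_atom \<sigma> ` body R"
  by (simp_all add: subst_rule_def)

lemma vars_rule_subst: "vars_rule (subst_rule \<sigma> R) = (\<Union>v\<in>vars_rule R. vars_trm (\<sigma> v))"
  by (auto simp: vars_rule_def vars_atom_subst)

lemma subst_atom_Var [simp]: "subst_atom Var a = a"
  by (simp add: subst_atom_def map_idI)

lemma subst_rule_Var: "subst_rule Var R = R"
  by (cases R) (simp add: subst_rule_def image_def)

lemma subst_rule_subst_rule:
  "subst_rule \<tau> (subst_rule \<sigma> R) = subst_rule (\<lambda>v. subst_trm \<tau> (\<sigma> v)) R"
  by (simp add: subst_rule_def subst_atom_def image_image subst_trm_subst_trm[abs_def] comp_def)

lemma variant_refl: "variant R R"
  unfolding variant_def by (intro exI[of _ id]) (simp add: subst_rule_Var)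

lemma variant_sym: "variant R S \<Longrightarrow> variant S R"
  unfolding variant_def
proof (elim exE conjE)
  fix \<pi> :: "nat \<Rightarrow> nat" assume \<pi>: "bij \<pi>" and S: "S = subst_rule (\<lambda>v. Var (\<pi> v)) R"
  have "R = subst_rule (\<lambda>v. Var (inv \<pi> v)) S"
    using \<pi> by (simp add: S subst_rule_subst_rule bij_is_inj subst_rule_Var)
  then show "\<exists>\<pi>. bij \<pi> \<and> R = subst_rule (\<lambda>v. Var (\<pi> v)) S"
    using \<pi> bij_imp_bij_inv by blast
qed

lemma variant_trans: "variant R S \<Longrightarrow> variant S T \<Longrightarrow> variant R T"
  unfolding variant_def
proof (elim exE conjE)
  fix \<pi> \<pi>' :: "nat \<Rightarrow> nat" assume "bij \<pi>" "bij \<pi>'" and S: "S = subst_rule (\<lambda>v. Var (\<pi> v)) R"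
    and T: "T = subst_rule (\<lambda>v. Var (\<pi>' v)) S"
  then show "\<exists>\<pi>. bij \<pi> \<and> T = subst_rule (\<lambda>v. Var (\<pi> v)) R"
    by (intro exI[of _ "\<pi>' \<circ> \<pi>"]) (simp add: S T subst_rule_subst_rule bij_comp)
qed

lemma adorned_eq_iff: "adorned p \<rho> = adorned p' \<rho>' \<longleftrightarrow> p = p' \<and> variant \<rho> \<rho>'"
  unfolding adorned_def using variant_refl variant_sym variant_trans by blast

lemma variant_hd_atom: "variant R S \<Longrightarrow> fst (hd_atom S) = fst (hd_atom R)"
  by (auto simp: variant_def)

lemma variant_finite_body: "variant R S \<Longrightarrow> finite (body R) \<Longrightarrow> finite (body S)"
  by (auto simp: variant_def)

text \<open>\<open>variant\<close> demands a bijection of all variables, so an injective shift does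
  not suffice; the block of the first \<open>m\<close> numbers is swapped with the next block
  instead.\<close>

lemma ex_bij_image_disjoint:
  fixes X Y :: "nat set"
  assumes "finite X" "finite Y"
  shows "\<exists>\<pi>. bij \<pi> \<and> \<pi> ` X \<inter> Y = {}"
proof -
  obtain m where m: "\<And>v. v \<in> X \<union> Y \<Longrightarrow> v < m"
    using finite_nat_set_iff_bounded assms by (metis finite_UnI)
  define \<pi> where "\<pi> v = (if v < m then v + m else if v < 2 * m then v - m else v)" for v
  have "\<pi> (\<pi> v) = v" for v
    by (auto simp: \<pi>_def)
  then have "bij \<pi>"
    by (intro o_bij[of \<pi> \<pi>]) (auto simp: fun_eq_iff)
  moreover have "\<pi> v \<ge> m" if "v \<in> X" for v
    using m that by (simp add: \<pi>_def)
  ultimately show ?thesis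
    using m by (intro exI[of _ \<pi>]) force
qed

text \<open>Rules are renamed one at a time, and the variables of each renamed rule join the
  forbidden set \<open>Y\<close> for the remaining ones. This supplies the variable-disjoint
  adornments that \<open>candidate\<close> requires.\<close>

lemma ex_variants_apart:
  assumes "finite I" "finite Y" "\<And>a. a \<in> I \<Longrightarrow> finite (vars_rule (r a))"
  shows "\<exists>r'. (\<forall>a\<in>I. variant (r a) (r' a) \<and> vars_rule (r' a) \<inter> Y = {}) \<and>
    (\<forall>a\<in>I. \<forall>b\<in>I. a \<noteq> b \<longrightarrow> vars_rule (r' a) \<inter> vars_rule (r' b) = {})"
  using assms
proof (induction I arbitrary: Y)
  case (insert a I)
  obtain \<pi> where \<pi>: "bij \<pi>" "\<pi> ` vars_rule (r a) \<inter> Y = {}"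
    using ex_bij_image_disjoint insert.prems by (metis insertI1)
  define s where "s = subst_rule (\<lambda>v. Var (\<pi> v)) (r a)"
  have vs: "vars_rule s = \<pi> ` vars_rule (r a)"
    by (auto simp: s_def vars_rule_subst)
  have "variant (r a) s"
    using \<pi> by (auto simp: variant_def s_def)
  have "finite (Y \<union> vars_rule s)"
    using insert.prems by (simp add: vs)
  then obtain r' where r': "\<forall>b\<in>I. variant (r b) (r' b) \<and> vars_rule (r' b) \<inter> (Y \<union> vars_rule s) = {}"
    "\<forall>b\<in>I. \<forall>c\<in>I. b \<noteq> c \<longrightarrow> vars_rule (r' b) \<inter> vars_rule (r' c) = {}"
    using insert.IH insert.prems(2) by (metis insertI2)
  show ?case
    using r' \<open>variant (r a) s\<close> \<pi>(2) insert.hyps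
    by (intro exI[of _ "r'(a := s)"]) (auto simp: vs[symmetric])
qed auto

section \<open>Most general unifiers\<close>

text \<open>
  Without function symbols, unifiable terms split into classes of terms that every unifier
  identifies, and mapping each variable to a representative of its class is a most general unifier.
\<close>

lemma mgu_exists:
  assumes "unifier \<tau>0 U"
  shows "\<exists>\<sigma>. mgu \<sigma> U"
proof -
  define eqv where "eqv s t \<longleftrightarrow> (\<forall>\<tau>. unifier \<tau> U \<longrightarrow> subst_trm \<tau> s = subst_trm \<tau> t)" for s t
  have eqv_refl: "eqv s s" for s by (simp add: eqv_def)
  have eqv_sym: "eqv s t \<Longrightarrow> eqv t s" for s t by (simp add: eqv_def)
  have eqv_trans: "eqv s t \<Longrightarrow> eqv t u \<Longrightarrow> eqv s u" for s t u by (simp add: eqv_def)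
  \<comment> \<open>Unifiability enters here: without any unifier, all terms would be vacuously
    equivalent.\<close>
  have eqv_Const: "c = d" if "eqv (Const c) (Const d)" for c d
    using that assms by (auto simp: eqv_def)
  \<comment> \<open>The representative is the constant of the class if there is one, and otherwise
    its least variable; both choices depend on the class alone.\<close>
  define \<sigma> where "\<sigma> v = (if \<exists>c. eqv (Var v) (Const c) then Const (SOME c. eqv (Var v) (Const c))
      else Var (LEAST w. eqv (Var v) (Var w)))" for v
  have \<sigma>_Const: "\<sigma> v = Const c" if "eqv (Var v) (Const c)" for v c
  proof -
    have "eqv (Var v) (Const (SOME c. eqv (Var v) (Const c)))"
      using that by (rule someI)
    then have "(SOME c. eqv (Var v) (Const c)) = c"
      using that eqv_sym eqv_trans eqv_Const by blast
    then show ?thesis using that by (auto simp: \<sigma>_def)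
  qed
  have eqv_\<sigma>: "eqv (Var v) (\<sigma> v)" for v
  proof (cases "\<exists>c. eqv (Var v) (Const c)")
    case True
    then show ?thesis using \<sigma>_Const by metis
  next
    case False
    then show ?thesis using LeastI[of "\<lambda>w. eqv (Var v) (Var w)" v] eqv_refl by (simp add: \<sigma>_def)
  qed
  have \<sigma>_Var: "\<sigma> v = \<sigma> w" if "eqv (Var v) (Var w)" for v w
  proof -
    have "eqv (Var v) t \<longleftrightarrow> eqv (Var w) t" for t
      using that eqv_sym eqv_trans by blast
    then show ?thesis by (simp add: \<sigma>_def)
  qed
  have \<sigma>_eqv: "subst_trm \<sigma> s = subst_trm \<sigma> t" if "eqv s t" for s t
    using that \<sigma>_Const \<sigma>_Var eqv_Const eqv_sym by (cases s; cases t) (auto, metis)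
  have "unifier \<sigma> U"
    unfolding unifier_def
  proof (intro ballI, clarify)
    fix s t assume st: "(s, t) \<in> U"
    then have *: "map (subst_trm \<tau>) s = map (subst_trm \<tau>) t" if "unifier \<tau> U" for \<tau>
      using that by (auto simp: unifier_def)
    have len: "length s = length t"
      using *[OF assms] map_eq_imp_length_eq by blast
    have "eqv (s ! i) (t ! i)" if "i < length s" for i
      unfolding eqv_def
    proof (intro allI impI)
      fix \<tau> assume "unifier \<tau> U"
      then have "map (subst_trm \<tau>) s ! i = map (subst_trm \<tau>) t ! i"
        using * by simp
      then show "subst_trm \<tau> (s ! i) = subst_trm \<tau> (t ! i)"
        using that len by simp
    qed
    then show "map (subst_trm \<sigma>) s = map (subst_trm \<sigma>) t"
      using len by (intro nth_equalityI) (auto intro: \<sigma>_eqv)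
  qed
  \<comment> \<open>A unifier identifies \<open>v\<close> with its representative, so it factors
    through \<open>\<sigma>\<close> with itself as the second factor.\<close>
  moreover have "\<tau> v = subst_trm \<tau> (\<sigma> v)" if "unifier \<tau> U" for \<tau> v
    using eqv_\<sigma>[of v] that by (auto simp: eqv_def)
  ultimately show ?thesis
    unfolding mgu_def by blast
qed

section \<open>Answers of a single rule\<close>

definition answers :: "('p \<Rightarrow> 'c list set) \<Rightarrow> ('p, 'c) rule \<Rightarrow> 'c list set" where
  "answers I \<rho> = {map (eval_trm \<theta>) (snd (hd_atom \<rho>)) | \<theta>.
     \<forall>a \<in> body \<rho>. map (eval_trm \<theta>) (snd a) \<in> I (fst a)}"

lemma answersI:
  "t = map (eval_trm \<theta>) (snd (hd_atom \<rho>)) \<Longrightarrow>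
   (\<And>a. a \<in> body \<rho> \<Longrightarrow> map (eval_trm \<theta>) (snd a) \<in> I (fst a)) \<Longrightarrow> t \<in> answers I \<rho>"
  by (auto simp: answers_def)

lemma answers_subst_rule: "answers I (subst_rule \<sigma> \<rho>) \<subseteq> answers I \<rho>"
proof
  fix t assume "t \<in> answers I (subst_rule \<sigma> \<rho>)"
  then obtain \<theta> where *: "t = map (eval_trm \<theta>) (snd (hd_atom (subst_rule \<sigma> \<rho>)))"
    "\<And>a. a \<in> body (subst_rule \<sigma> \<rho>) \<Longrightarrow> map (eval_trm \<theta>) (snd a) \<in> I (fst a)"
    unfolding answers_def by blast
  show "t \<in> answers I \<rho>"
  proof (rule answersI)
    show "t = map (eval_trm (\<lambda>v. eval_trm \<theta> (\<sigma> v))) (snd (hd_atom \<rho>))"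
      using *(1) by (simp add: eval_trm_subst_trm)
    show "map (eval_trm (\<lambda>v. eval_trm \<theta> (\<sigma> v))) (snd a) \<in> I (fst a)" if "a \<in> body \<rho>" for a
      using *(2)[of "subst_atom \<sigma> a"] that by (simp add: eval_trm_subst_trm comp_def)
  qed
qed

text \<open>A renaming can be undone, so the inclusion for instances applies in both directions. The
  answers thus depend only on the class stored in an adorned predicate.\<close>

lemma answers_variant: "variant \<rho> \<rho>' \<Longrightarrow> answers I \<rho> = answers I \<rho>'"
  using variant_sym answers_subst_rule unfolding variant_def by (metis subset_antisym)

section \<open>Masked rules\<close>

lemma g_out_exists:
  assumes "finite (body \<rho>0)"
  shows "\<exists>\<rho>. g_out \<rho>0 \<rho>"
proof -
  define B where "B = irredundant (mask (set (snd (hd_atom \<rho>0))) ` body \<rho>0)"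
  define occs where "occs = (SIGMA a:B. {..<length (snd a)})"
  have "finite occs"
    using assms by (auto simp: occs_def B_def irredundant_def)
  then obtain f :: "('a, 'b) masked_atom \<times> nat \<Rightarrow> nat" where f: "inj_on f occs"
    using finite_imp_inj_to_nat_seg by metis
  obtain m where m: "\<And>v. v \<in> vars_atom (hd_atom \<rho>0) \<Longrightarrow> v < m"
    using finite_nat_set_iff_bounded finite_vars_atom by metis
  \<comment> \<open>Shifting by \<open>m\<close> moves the anonymous variables beyond all head
    variables.\<close>
  have "inj_on (\<lambda>x. f x + m) occs"
    using f by (auto simp: inj_on_def)
  moreover have "(\<lambda>x. f x + m) ` occs \<inter> vars_atom (hd_atom \<rho>0) = {}"
    using m by force
  ultimately show ?thesis
    unfolding g_out_def Let_def B_def[symmetric] occs_def[symmetric] by blast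
qed

lemma g_outE:
  assumes "g_out \<rho>0 \<rho>"
  obtains \<nu> B where "B = irredundant (mask (set (snd (hd_atom \<rho>0))) ` body \<rho>0)"
    "inj_on \<nu> (SIGMA a:B. {..<length (snd a)})"
    "\<nu> ` (SIGMA a:B. {..<length (snd a)}) \<inter> vars_atom (hd_atom \<rho>0) = {}"
    "hd_atom \<rho> = hd_atom \<rho>0" "body \<rho> = unmask \<nu> ` B"
  using assms unfolding g_out_def Let_def by auto

lemma g_out_hd_atom: "g_out \<rho>0 \<rho> \<Longrightarrow> hd_atom \<rho> = hd_atom \<rho>0"
  by (elim g_outE)

lemma irredundant_subset: "irredundant M \<subseteq> M"
  by (auto simp: irredundant_def)

text \<open>Each kept atom is the masked form of some original atom, and a fresh variable can take
  the value that the masked argument had there. The reverse inclusion fails in general, since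
  masking forgets joins over non-head variables.\<close>

lemma answers_g_out:
  assumes "g_out \<rho>0 \<rho>"
  shows "answers I \<rho>0 \<subseteq> answers I \<rho>"
proof
  fix t assume "t \<in> answers I \<rho>0"
  then obtain \<theta> where \<theta>: "t = map (eval_trm \<theta>) (snd (hd_atom \<rho>0))"
    "\<And>a. a \<in> body \<rho>0 \<Longrightarrow> map (eval_trm \<theta>) (snd a) \<in> I (fst a)"
    unfolding answers_def by blast
  define H where "H = set (snd (hd_atom \<rho>0))"
  from assms obtain \<nu> B where B: "B = irredundant (mask H ` body \<rho>0)"
    and inj: "inj_on \<nu> (SIGMA a:B. {..<length (snd a)})"
    and disj: "\<nu> ` (SIGMA a:B. {..<length (snd a)}) \<inter> vars_atom (hd_atom \<rho>0) = {}"
    and \<rho>: "hd_atom \<rho> = hd_atom \<rho>0" "body \<rho> = unmask \<nu> ` B"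
    unfolding H_def by (rule g_outE)
  let ?O = "SIGMA a:B. {..<length (snd a)}"
  have "\<exists>b\<in>body \<rho>0. mask H b = a" if "a \<in> B" for a
    using that irredundant_subset unfolding B by blast
  then obtain pre where pre: "\<And>a. a \<in> B \<Longrightarrow> pre a \<in> body \<rho>0" "\<And>a. a \<in> B \<Longrightarrow> mask H (pre a) = a"
    by metis
  \<comment> \<open>Each anonymous occurrence has its own variable, so the inverse of
    \<open>\<nu>\<close> recovers the position whose original value is to be copied. Several
    original atoms may have the same masked form; \<open>pre\<close> fixes one of them.\<close>
  define \<theta>' where "\<theta>' v = (if v \<in> \<nu> ` ?O
      then (let (a, i) = inv_into ?O \<nu> v in eval_trm \<theta> (snd (pre a) ! i)) else \<theta> v)" for v
  have anon: "\<theta>' (\<nu> (a, i)) = eval_trm \<theta> (snd (pre a) ! i)" if "a \<in> B" "i < length (snd a)" for a i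
  proof -
    have "(a, i) \<in> ?O" using that by auto
    with inj show ?thesis by (auto simp: \<theta>'_def)
  qed
  have head: "eval_trm \<theta>' s = eval_trm \<theta> s" if "s \<in> H" for s
  proof (rule eval_trm_cong)
    fix v assume "v \<in> vars_trm s"
    then have "v \<in> vars_atom (hd_atom \<rho>0)" using that by (auto simp: H_def vars_atom_def)
    then show "\<theta>' v = \<theta> v" using disj unfolding \<theta>'_def by auto
  qed
  show "t \<in> answers I \<rho>"
  proof (rule answersI)
    show "t = map (eval_trm \<theta>') (snd (hd_atom \<rho>))"
      using \<theta>(1) head by (auto simp: \<rho> H_def)
    fix u assume "u \<in> body \<rho>"
    then obtain a where a: "a \<in> B" "u = unmask \<nu> a" by (auto simp: \<rho>)
    have fst_a: "fst a = fst (pre a)"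
      and snd_a: "snd a = map (\<lambda>t. if t \<in> H then Some t else None) (snd (pre a))"
      by (subst pre(2)[OF a(1), symmetric], simp add: mask_def)+
    then have len: "length (snd a) = length (snd (pre a))" by simp
    have "map (eval_trm \<theta>') (snd u) = map (eval_trm \<theta>) (snd (pre a))"
    proof (rule nth_equalityI)
      fix i assume "i < length (map (eval_trm \<theta>') (snd u))"
      then have i: "i < length (snd a)" by (simp add: a unmask_def)
      then have "snd a ! i = (if snd (pre a) ! i \<in> H then Some (snd (pre a) ! i) else None)"
        using len by (subst snd_a) simp
      then show "map (eval_trm \<theta>') (snd u) ! i = map (eval_trm \<theta>) (snd (pre a)) ! i"
        using i len anon[OF a(1) i] head by (auto simp: a(2) unmask_def)
    qed (simp add: a(2) unmask_def len)
    then show "map (eval_trm \<theta>') (snd u) \<in> I (fst u)"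
      using \<theta>(2)[OF pre(1)[OF a(1)]] fst_a by (simp add: a(2) unmask_def)
  qed
qed

section \<open>Survival of head arguments under masking\<close>

lemma length_filter_less:
  assumes "list_all2 (\<lambda>t t'. t = t' \<or> t = None) xs ys" "xs \<noteq> ys"
  shows "length (filter (\<lambda>t. t \<noteq> None) xs) < length (filter (\<lambda>t. t \<noteq> None) ys)"
proof -
  have "length (filter (\<lambda>t. t \<noteq> None) xs) \<le> length (filter (\<lambda>t. t \<noteq> None) ys) \<and>
    (xs \<noteq> ys \<longrightarrow> length (filter (\<lambda>t. t \<noteq> None) xs) < length (filter (\<lambda>t. t \<noteq> None) ys))"
    using assms(1) by (induction rule: list_all2_induct) auto
  then show ?thesis using assms(2) by blast
qed

text \<open>Among the atoms that contain \<open>t\<close>, one with the most unmasked entries is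
  kept: an atom subsuming it would also contain \<open>t\<close> and have strictly more such
  entries.\<close>

lemma irredundant_covers:
  assumes "finite M" "a \<in> M" "Some t \<in> set (snd a)"
  shows "\<exists>b \<in> irredundant M. Some t \<in> set (snd b)"
proof -
  define size where "size b = length (filter (\<lambda>t. t \<noteq> None) (snd b))" for b :: "('a, 'b) masked_atom"
  define C where "C = {b \<in> M. Some t \<in> set (snd b)}"
  have "a \<in> C" using assms by (simp add: C_def)
  moreover have "finite C" using assms(1) by (simp add: C_def)
  ultimately obtain b where b: "b \<in> C" "\<And>c. c \<in> C \<Longrightarrow> size c \<le> size b"
    using Max_in[of "size ` C"] Max_ge[of "size ` C"] by fastforce
  have "False" if c: "c \<in> M" "c \<noteq> b" "subsumed b c" for c
  proof -
    from c have l: "list_all2 (\<lambda>t t'. t = t' \<or> t = None) (snd b) (snd c)" "snd b \<noteq> snd c"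
      by (auto simp: subsumed_def prod_eq_iff)
    obtain i where "i < length (snd b)" "snd b ! i = Some t"
      using b(1) by (auto simp: C_def in_set_conv_nth)
    then have "Some t \<in> set (snd c)"
      using l(1) by (force simp: in_set_conv_nth list_all2_conv_all_nth)
    then have "c \<in> C" using c by (simp add: C_def)
    moreover have "size b < size c"
      using length_filter_less[OF l] by (simp add: size_def)
    ultimately show False using b(2)[of c] by simp
  qed
  then have "b \<in> irredundant M"
    using b(1) by (auto simp: irredundant_def C_def)
  then show ?thesis using b(1) by (auto simp: C_def)
qed

text \<open>The invariant of all adornments produced by the algorithm: finiteness and safety are
  what the cover bound asks for, and EDB predicates in the body are those whose relations
  \<open>N\<close> controls.\<close>

definition edb_rule :: "('p, 'c) program \<Rightarrow> ('p, 'c) rule \<Rightarrow> bool" where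
  "edb_rule \<Pi> \<rho> \<longleftrightarrow> finite (body \<rho>) \<and> safe \<rho> \<and> (\<forall>a \<in> body \<rho>. fst a \<notin> idb \<Pi>)"

lemma edb_rule_variant:
  assumes "edb_rule \<Pi> \<rho>" "variant \<rho> \<rho>'"
  shows "edb_rule \<Pi> \<rho>'"
proof -
  obtain \<pi> where \<pi>: "\<rho>' = subst_rule (\<lambda>v. Var (\<pi> v)) \<rho>"
    using assms(2) by (auto simp: variant_def)
  have "safe \<rho>'"
    using assms(1) unfolding edb_rule_def safe_def \<pi> by (simp add: vars_atom_subst) blast
  then show ?thesis
    using assms(1) by (auto simp: edb_rule_def \<pi>)
qed

text \<open>Safety is the delicate point: a head variable is never masked, and removing subsumed
  atoms always leaves some atom that contains it.\<close>

lemma edb_rule_g_out: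
  assumes "edb_rule \<Pi> \<rho>0" "g_out \<rho>0 \<rho>"
  shows "edb_rule \<Pi> \<rho>"
proof -
  define H where "H = set (snd (hd_atom \<rho>0))"
  from assms(2) obtain \<nu> B where B: "B = irredundant (mask H ` body \<rho>0)"
    and \<rho>: "hd_atom \<rho> = hd_atom \<rho>0" "body \<rho> = unmask \<nu> ` B"
    unfolding H_def by (rule g_outE)
  have fin: "finite (mask H ` body \<rho>0)" using assms(1) by (simp add: edb_rule_def)
  have "finite (body \<rho>)"
    unfolding \<rho> B using fin irredundant_subset by (blast intro: finite_subset)
  moreover have "fst u \<notin> idb \<Pi>" if "u \<in> body \<rho>" for u
  proof -
    obtain a where "a \<in> mask H ` body \<rho>0" "u = unmask \<nu> a"
      using \<open>u \<in> body \<rho>\<close> irredundant_subset unfolding \<rho> B by blast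
    then show ?thesis
      using assms(1) by (auto simp: unmask_def mask_def edb_rule_def)
  qed
  moreover have "v \<in> (\<Union>u\<in>body \<rho>. vars_atom u)" if v: "v \<in> vars_atom (hd_atom \<rho>)" for v
  proof -
    have vH: "Var v \<in> H"
      using v by (auto simp: \<rho> H_def in_vars_atom_iff)
    obtain a where a: "a \<in> body \<rho>0" "v \<in> vars_atom a"
      using assms(1) v by (auto simp: edb_rule_def safe_def \<rho>)
    then have "Var v \<in> set (snd a)"
      by (simp add: in_vars_atom_iff)
    with vH have "Some (Var v) \<in> set (snd (mask H a))"
      by (force simp: mask_def)
    then obtain b where b: "b \<in> B" "Some (Var v) \<in> set (snd b)"
      unfolding B using irredundant_covers[OF fin] a(1) by blast
    then obtain i where i: "i < length (snd b)" "snd b ! i = Some (Var v)"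
      by (auto simp: in_set_conv_nth)
    have "Var v \<in> set (snd (unmask \<nu> b))"
      using i by (force simp: unmask_def)
    then show ?thesis
      using b(1) unfolding \<rho> by (auto simp: in_vars_atom_iff)
  qed
  ultimately show ?thesis by (auto simp: edb_rule_def safe_def)
qed

section \<open>Completeness of the adornments\<close>

lemma subst_trm_Const: "subst_trm (\<lambda>v. Const (\<theta> v)) t = Const (eval_trm \<theta> t)"
  by (cases t) auto

text \<open>
  The valuations of the rule and of the adornments, which share no variables, combine to a ground
  unifier. It factors through the most general unifier, which yields a valuation of the merged rule.
\<close>

lemma ex_candidate:
  assumes R: "R \<in> \<Pi>" "finite (body R)"
    and edb: "\<And>a. a \<in> edb_atoms \<Pi> R \<Longrightarrow> map (eval_trm \<theta>) (snd a) \<in> I (fst a)"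
    and idb: "\<And>a. a \<in> idb_atoms \<Pi> R \<Longrightarrow> \<exists>S \<in> P. \<exists>\<rho>. fst (hd_atom S) = adorned (fst a) \<rho> \<and>
      fst (hd_atom \<rho>) = fst a \<and> finite (body \<rho>) \<and> map (eval_trm \<theta>) (snd a) \<in> answers I \<rho>"
  shows "\<exists>R' \<rho>. candidate g_out \<Pi> P R' \<and> fst (hd_atom R') = adorned (fst (hd_atom R)) \<rho> \<and>
    fst (hd_atom \<rho>) = fst (hd_atom R) \<and> map (eval_trm \<theta>) (snd (hd_atom R)) \<in> answers I \<rho>"
proof -
  let ?A = "idb_atoms \<Pi> R"
  have finA: "finite ?A" "finite (edb_atoms \<Pi> R)"
    using R(2) by (simp_all add: idb_atoms_def edb_atoms_def)
  from idb have "\<forall>a\<in>?A. \<exists>\<rho>. (\<exists>S \<in> P. fst (hd_atom S) = adorned (fst a) \<rho>) \<and>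
      fst (hd_atom \<rho>) = fst a \<and> finite (body \<rho>) \<and> map (eval_trm \<theta>) (snd a) \<in> answers I \<rho>"
    by blast
  from bchoice[OF this] obtain r where r: "\<forall>a\<in>?A. (\<exists>S \<in> P. fst (hd_atom S) = adorned (fst a) (r a)) \<and>
      fst (hd_atom (r a)) = fst a \<and> finite (body (r a)) \<and>
      map (eval_trm \<theta>) (snd a) \<in> answers I (r a)" ..
  have "\<exists>\<rho>s. (\<forall>a\<in>?A. variant (r a) (\<rho>s a) \<and> vars_rule (\<rho>s a) \<inter> vars_rule R = {}) \<and>
    (\<forall>a\<in>?A. \<forall>b\<in>?A. a \<noteq> b \<longrightarrow> vars_rule (\<rho>s a) \<inter> vars_rule (\<rho>s b) = {})"
    using finA R(2) r by (intro ex_variants_apart) (auto intro: finite_vars_rule)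
  then obtain \<rho>s where apart: "\<forall>a\<in>?A. variant (r a) (\<rho>s a) \<and> vars_rule (\<rho>s a) \<inter> vars_rule R = {}"
    "\<forall>a\<in>?A. \<forall>b\<in>?A. a \<noteq> b \<longrightarrow> vars_rule (\<rho>s a) \<inter> vars_rule (\<rho>s b) = {}"
    by (elim exE conjE)
  have variant: "\<And>a. a \<in> ?A \<Longrightarrow> variant (r a) (\<rho>s a)"
    and disj_R: "\<And>a. a \<in> ?A \<Longrightarrow> vars_rule (\<rho>s a) \<inter> vars_rule R = {}"
    and disj: "\<And>a b. a \<in> ?A \<Longrightarrow> b \<in> ?A \<Longrightarrow> a \<noteq> b \<Longrightarrow> vars_rule (\<rho>s a) \<inter> vars_rule (\<rho>s b) = {}"
    using apart by auto
  have \<rho>s: "\<exists>S \<in> P. fst (hd_atom S) = adorned (fst a) (\<rho>s a)" "fst (hd_atom (\<rho>s a)) = fst a"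
    "finite (body (\<rho>s a))" "map (eval_trm \<theta>) (snd a) \<in> answers I (\<rho>s a)" if a: "a \<in> ?A" for a
  proof -
    have "adorned (fst a) (r a) = adorned (fst a) (\<rho>s a)"
      using variant[OF a] by (simp add: adorned_eq_iff)
    then show "\<exists>S \<in> P. fst (hd_atom S) = adorned (fst a) (\<rho>s a)"
      using r a by metis
    show "fst (hd_atom (\<rho>s a)) = fst a"
      using r a variant_hd_atom[OF variant[OF a]] by simp
    show "finite (body (\<rho>s a))"
      using r a variant_finite_body[OF variant[OF a]] by blast
    show "map (eval_trm \<theta>) (snd a) \<in> answers I (\<rho>s a)"
      using r a answers_variant[OF variant[OF a]] by metis
  qed
  have "\<forall>a\<in>?A. \<exists>\<eta>. map (eval_trm \<theta>) (snd a) = map (eval_trm \<eta>) (snd (hd_atom (\<rho>s a))) \<and>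
      (\<forall>b\<in>body (\<rho>s a). map (eval_trm \<eta>) (snd b) \<in> I (fst b))"
    using \<rho>s(4) unfolding answers_def by blast
  from bchoice[OF this] obtain th where "\<forall>a\<in>?A. map (eval_trm \<theta>) (snd a) = map (eval_trm (th a)) (snd (hd_atom (\<rho>s a))) \<and>
      (\<forall>b\<in>body (\<rho>s a). map (eval_trm (th a)) (snd b) \<in> I (fst b))" ..
  then have th_head: "map (eval_trm \<theta>) (snd a) = map (eval_trm (th a)) (snd (hd_atom (\<rho>s a)))"
    and th_body: "b \<in> body (\<rho>s a) \<Longrightarrow> map (eval_trm (th a)) (snd b) \<in> I (fst b)"
    if "a \<in> ?A" for a b
    using that by auto
  \<comment> \<open>By disjointness at most one adornment contains a given \<open>v\<close>, so the
    choice is forced wherever it matters; variables of no rule get an irrelevant value.\<close>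
  define \<theta>' where "\<theta>' v = (if v \<in> vars_rule R then \<theta> v
      else th (SOME a. a \<in> ?A \<and> v \<in> vars_rule (\<rho>s a)) v)" for v
  have \<theta>'_R: "\<theta>' v = \<theta> v" if "v \<in> vars_rule R" for v
    using that by (simp add: \<theta>'_def)
  have \<theta>'_\<rho>s: "\<theta>' v = th a v" if "a \<in> ?A" "v \<in> vars_rule (\<rho>s a)" for a v
  proof -
    have "(SOME a. a \<in> ?A \<and> v \<in> vars_rule (\<rho>s a)) = a"
      using that disj by (intro some_equality) blast+
    then show ?thesis using that disj_R[OF that(1)] by (auto simp: \<theta>'_def)
  qed
  have eval_R: "map (eval_trm \<theta>') (snd a) = map (eval_trm \<theta>) (snd a)"
    if "a = hd_atom R \<or> a \<in> body R" for a
    using that by (intro map_eval_trm_cong \<theta>'_R) (auto simp: vars_rule_def)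
  have eval_\<rho>s: "map (eval_trm \<theta>') (snd b) = map (eval_trm (th a)) (snd b)"
    if "a \<in> ?A" "b = hd_atom (\<rho>s a) \<or> b \<in> body (\<rho>s a)" for a b
    using that by (intro map_eval_trm_cong \<theta>'_\<rho>s) (auto simp: vars_rule_def)
  let ?U = "(\<lambda>a. (snd a, snd (hd_atom (\<rho>s a)))) ` ?A"
  have "unifier (\<lambda>v. Const (\<theta>' v)) ?U"
    unfolding unifier_def
  proof clarify
    fix p ts assume a: "(p, ts) \<in> ?A"
    have "map (eval_trm \<theta>') ts = map (eval_trm \<theta>) ts"
      using eval_R[of "(p, ts)"] a by (simp add: idb_atoms_def)
    also have "\<dots> = map (eval_trm (th (p, ts))) (snd (hd_atom (\<rho>s (p, ts))))"
      using th_head[OF a] by (simp only: snd_conv)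
    also have "\<dots> = map (eval_trm \<theta>') (snd (hd_atom (\<rho>s (p, ts))))"
      using eval_\<rho>s[OF a, of "hd_atom (\<rho>s (p, ts))"] by simp
    finally have "map (eval_trm \<theta>') ts = map (eval_trm \<theta>') (snd (hd_atom (\<rho>s (p, ts))))" .
    from arg_cong[OF this, of "map Const"]
    show "map (subst_trm (\<lambda>v. Const (\<theta>' v))) (snd (p, ts))
        = map (subst_trm (\<lambda>v. Const (\<theta>' v))) (snd (hd_atom (\<rho>s (p, ts))))"
      by (simp add: subst_trm_Const[abs_def] comp_def)
  qed
  moreover from this obtain \<sigma> where \<sigma>: "mgu \<sigma> ?U"
    using mgu_exists by blast
  ultimately obtain \<delta> where \<delta>: "\<And>v. Const (\<theta>' v) = subst_trm \<delta> (\<sigma> v)"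
    unfolding mgu_def by blast
  \<comment> \<open>Wherever \<open>\<sigma>\<close> produces a variable, \<open>\<delta>\<close>
    must send it to a constant, because the composition is ground; \<open>\<eta>\<close> reads off
    these constants.\<close>
  define \<eta> where "\<eta> v = (case \<delta> v of Const c \<Rightarrow> c | Var _ \<Rightarrow> undefined)" for v
  have "eval_trm \<eta> (\<sigma> v) = \<theta>' v" for v
    using \<delta>[of v] by (cases "\<sigma> v") (auto simp: \<eta>_def split: trm.splits)
  then have \<eta>: "map (eval_trm \<eta>) (map (subst_trm \<sigma>) ts) = map (eval_trm \<theta>') ts" for ts
    by (simp add: eval_trm_subst_trm)
  let ?\<rho>0 = "Rule (subst_atom \<sigma> (hd_atom R))
          ((\<Union>a \<in> ?A. subst_atom \<sigma> ` body (\<rho>s a)) \<union> subst_atom \<sigma> ` edb_atoms \<Pi> R)"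
  have "map (eval_trm \<theta>) (snd (hd_atom R)) \<in> answers I ?\<rho>0"
  proof (rule answersI)
    show "map (eval_trm \<theta>) (snd (hd_atom R)) = map (eval_trm \<eta>) (snd (hd_atom ?\<rho>0))"
      by (simp add: \<eta> eval_R[of "hd_atom R"] del: map_map map_eq_conv)
    fix u assume "u \<in> body ?\<rho>0"
    then consider a b where "a \<in> ?A" "b \<in> body (\<rho>s a)" "u = subst_atom \<sigma> b"
      | b where "b \<in> edb_atoms \<Pi> R" "u = subst_atom \<sigma> b"
      by auto
    then show "map (eval_trm \<eta>) (snd u) \<in> I (fst u)"
    proof cases
      case 1
      then show ?thesis using th_body eval_\<rho>s[of a b] by (simp add: \<eta> del: map_map map_eq_conv)
    next
      case 2
      then show ?thesis using edb eval_R[of b] by (simp add: \<eta> edb_atoms_def del: map_map map_eq_conv)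
    qed
  qed
  moreover obtain \<rho> where \<rho>: "g_out ?\<rho>0 \<rho>"
    using g_out_exists[of ?\<rho>0] finA \<rho>s(3) by auto
  ultimately have ans: "map (eval_trm \<theta>) (snd (hd_atom R)) \<in> answers I \<rho>"
    using answers_g_out by blast
  let ?R' = "Rule (adorned (fst (hd_atom R)) \<rho>, map (subst_trm \<sigma>) (snd (hd_atom R)))
       ((\<lambda>a. (adorned (fst a) (\<rho>s a), map (subst_trm \<sigma>) (snd a))) ` idb_atoms \<Pi> R
          \<union> (\<lambda>a. (Edb (fst a), map (subst_trm \<sigma>) (snd a))) ` edb_atoms \<Pi> R)"
  have "candidate g_out \<Pi> P ?R'"
    unfolding candidate_def
    using \<rho>s(1,2) disj_R disj \<sigma> \<rho>
    by (intro bexI[OF _ R(1)] exI[of _ \<rho>s] exI[of _ \<sigma>] exI[of _ \<rho>]) simp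
  moreover have "fst (hd_atom \<rho>) = fst (hd_atom R)"
    using g_out_hd_atom[OF \<rho>] by simp
  ultimately show ?thesis
    using ans by (intro exI[of _ ?R'] exI[of _ \<rho>]) simp
qed

text \<open>A head variable of the merged rule stems from a body atom of \<open>R\<close>. If that
  atom is IDB, the unifier equates its arguments with the head of a safe adornment, whose body then
  contains the variable. The given \<open>\<rho>\<close> may be another representative, so the
  result is finally carried over to variants.\<close>

lemma candidate_edb_rule:
  assumes "datalog_program ar \<Pi>" "candidate g_out \<Pi> P R'"
    and P: "\<And>S p \<rho>. S \<in> P \<Longrightarrow> fst (hd_atom S) = adorned p \<rho> \<Longrightarrow> edb_rule \<Pi> \<rho> \<and> fst (hd_atom \<rho>) = p"
    and "fst (hd_atom R') = adorned p \<rho>"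
  shows "edb_rule \<Pi> \<rho> \<and> fst (hd_atom \<rho>) = p"
proof -
  from assms(2) obtain R \<rho>s \<sigma> \<rho>' where R: "R \<in> \<Pi>"
    and mgu: "mgu \<sigma> ((\<lambda>a. (snd a, snd (hd_atom (\<rho>s a)))) ` idb_atoms \<Pi> R)"
    and g: "g_out (Rule (subst_atom \<sigma> (hd_atom R))
          ((\<Union>a \<in> idb_atoms \<Pi> R. subst_atom \<sigma> ` body (\<rho>s a))
             \<union> subst_atom \<sigma> ` edb_atoms \<Pi> R)) \<rho>'"
    and R': "fst (hd_atom R') = adorned (fst (hd_atom R)) \<rho>'"
    and \<rho>s: "\<forall>a \<in> idb_atoms \<Pi> R. \<exists>S \<in> P. fst (hd_atom S) = adorned (fst a) (\<rho>s a)"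
    unfolding candidate_def
    by (elim bexE exE conjE) (rule that, assumption, assumption, assumption, simp, blast)
  define \<rho>0 where "\<rho>0 = Rule (subst_atom \<sigma> (hd_atom R))
          ((\<Union>a \<in> idb_atoms \<Pi> R. subst_atom \<sigma> ` body (\<rho>s a)) \<union> subst_atom \<sigma> ` edb_atoms \<Pi> R)"
  have R_fin: "finite (body R)" and R_safe: "safe R"
    using assms(1) R by (auto simp: datalog_program_def)
  have good: "edb_rule \<Pi> (\<rho>s a)" if "a \<in> idb_atoms \<Pi> R" for a
    using \<rho>s P that by blast
  have "v \<in> (\<Union>b\<in>body \<rho>0. vars_atom b)" if v: "v \<in> vars_atom (hd_atom \<rho>0)" for v
  proof -
    have "vars_atom (subst_atom \<sigma> a) \<subseteq> (\<Union>b\<in>body \<rho>0. vars_atom b)" if a: "a \<in> body R" for a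
    proof (cases "fst a \<in> idb \<Pi>")
      case True
      with a have a': "a \<in> idb_atoms \<Pi> R" by (simp add: idb_atoms_def)
      let ?h = "hd_atom (\<rho>s a)"
      have "map (subst_trm \<sigma>) (snd a) = map (subst_trm \<sigma>) (snd ?h)"
        using mgu a' unfolding mgu_def unifier_def by blast
      then have "vars_atom (subst_atom \<sigma> a) = vars_atom (subst_atom \<sigma> ?h)"
        by (simp add: vars_atom_def del: set_map)
      also have "\<dots> \<subseteq> (\<Union>b\<in>body (\<rho>s a). vars_atom (subst_atom \<sigma> b))"
        using good[OF a'] by (fastforce simp: edb_rule_def safe_def vars_atom_subst)
      finally show ?thesis using a' by (auto simp: \<rho>0_def)
    next
      case False
      with a show ?thesis by (auto simp: \<rho>0_def edb_atoms_def)
    qed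
    moreover obtain w where "w \<in> vars_atom (hd_atom R)" "v \<in> vars_trm (\<sigma> w)"
      using v by (auto simp: \<rho>0_def vars_atom_subst)
    moreover then obtain a where "a \<in> body R" "w \<in> vars_atom a"
      using R_safe by (auto simp: safe_def)
    ultimately show ?thesis unfolding vars_atom_subst by blast
  qed
  moreover have "finite (body \<rho>0)"
    using R_fin good by (auto simp: \<rho>0_def idb_atoms_def edb_atoms_def edb_rule_def)
  moreover have "\<forall>b\<in>body \<rho>0. fst b \<notin> idb \<Pi>"
  proof
    fix b assume "b \<in> body \<rho>0"
    then consider a c where "a \<in> idb_atoms \<Pi> R" "c \<in> body (\<rho>s a)" "fst b = fst c" | "fst b \<notin> idb \<Pi>"
      by (auto simp: \<rho>0_def edb_atoms_def)
    then show "fst b \<notin> idb \<Pi>"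
      by cases (use good in \<open>auto simp: edb_rule_def\<close>)
  qed
  ultimately have "edb_rule \<Pi> \<rho>0"
    by (auto simp: edb_rule_def safe_def)
  then have "edb_rule \<Pi> \<rho>'"
    using g edb_rule_g_out unfolding \<rho>0_def by blast
  moreover have "fst (hd_atom \<rho>') = fst (hd_atom R)"
    using g_out_hd_atom[OF g] by simp
  moreover have "fst (hd_atom R) = p" "variant \<rho>' \<rho>"
    using R' assms(4) by (auto simp: adorned_eq_iff intro: variant_sym)
  ultimately show ?thesis
    using edb_rule_variant variant_hd_atom by metis
qed

lemma adorn_steps_edb_rule:
  assumes "(adorn_step g_out h \<Pi>)\<^sup>*\<^sup>* {} P" "datalog_program ar \<Pi>"
  shows "finite P \<and> (\<forall>S \<in> P. \<forall>p \<rho>. fst (hd_atom S) = adorned p \<rho> \<longrightarrow> edb_rule \<Pi> \<rho> \<and> fst (hd_atom \<rho>) = p)"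
  using assms(1)
proof (induction rule: rtranclp_induct)
  case (step P P')
  then show ?case
    using candidate_edb_rule[OF assms(2), of P] unfolding adorn_step_def by blast
qed simp

text \<open>Only derivations by rules matter, since an instance is empty on IDB predicates.
  Adornments answering the IDB atoms of the last rule give a candidate, and saturation of
  \<open>P\<close> makes its adornment available.\<close>

lemma derivable_adorned:
  assumes prog: "datalog_program ar \<Pi>" and out: "adornment_output g_out h_eq \<Pi> P"
    and D: "\<And>p. p \<in> idb \<Pi> \<Longrightarrow> D p = {}"
    and "derivable \<Pi> D p t"
  shows "p \<in> idb \<Pi> \<Longrightarrow> \<exists>S \<in> P. \<exists>\<rho>. fst (hd_atom S) = adorned p \<rho> \<and> t \<in> answers (rel \<Pi> D) \<rho>"
  using assms(4)
proof (induction rule: derivable.induct)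
  case (from_edb t p)
  then show ?case using D by auto
next
  case (from_rule R \<theta>)
  have steps: "(adorn_step g_out h_eq \<Pi>)\<^sup>*\<^sup>* {} P" and fixp: "\<not> adorn_step g_out h_eq \<Pi> P P'" for P'
    using out by (auto simp: adornment_output_def)
  have good: "edb_rule \<Pi> \<rho> \<and> fst (hd_atom \<rho>) = p" if "S \<in> P" "fst (hd_atom S) = adorned p \<rho>" for S p \<rho>
    using adorn_steps_edb_rule[OF steps prog] that by blast
  have "\<exists>R' \<rho>. candidate g_out \<Pi> P R' \<and> fst (hd_atom R') = adorned (fst (hd_atom R)) \<rho> \<and>
    fst (hd_atom \<rho>) = fst (hd_atom R) \<and> map (eval_trm \<theta>) (snd (hd_atom R)) \<in> answers (rel \<Pi> D) \<rho>"
  proof (rule ex_candidate)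
    show "finite (body R)"
      using prog from_rule by (auto simp: datalog_program_def)
    show "map (eval_trm \<theta>) (snd a) \<in> rel \<Pi> D (fst a)" if "a \<in> edb_atoms \<Pi> R" for a
      using that from_rule by (auto simp: edb_atoms_def rel_def)
    show "\<exists>S \<in> P. \<exists>\<rho>. fst (hd_atom S) = adorned (fst a) \<rho> \<and> fst (hd_atom \<rho>) = fst a \<and>
        finite (body \<rho>) \<and> map (eval_trm \<theta>) (snd a) \<in> answers (rel \<Pi> D) \<rho>"
      if "a \<in> idb_atoms \<Pi> R" for a
    proof -
      have a: "a \<in> body R" "fst a \<in> idb \<Pi>"
        using that by (auto simp: idb_atoms_def)
      then obtain S \<rho> where "S \<in> P" "fst (hd_atom S) = adorned (fst a) \<rho>"
        "map (eval_trm \<theta>) (snd a) \<in> answers (rel \<Pi> D) \<rho>"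
        using from_rule.IH by blast
      then show ?thesis using good unfolding edb_rule_def by blast
    qed
  qed (use from_rule in simp)
  then obtain R' \<rho> where R': "candidate g_out \<Pi> P R'" "fst (hd_atom R') = adorned (fst (hd_atom R)) \<rho>"
    "map (eval_trm \<theta>) (snd (hd_atom R)) \<in> answers (rel \<Pi> D) \<rho>"
    by blast
  \<comment> \<open>No step applies to \<open>P\<close>, so the candidate must be rejected as a
    variant of an existing rule. Renaming leaves the head predicate, adornment included,
    unchanged.\<close>
  then have "h_eq R' P"
    using fixp unfolding adorn_step_def by blast
  then obtain S where "S \<in> P" "variant R' S"
    by (auto simp: h_eq_def)
  then show ?case
    using R' variant_hd_atom by metis
qed

section \<open>Fractional edge-cover width\<close>

text \<open>Weights belong to sets of variables, so the renamed cover looks up the preimage of an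
  edge under the renaming.\<close>

lemma fractional_cover_rename:
  assumes "bij \<pi>" "fractional_cover \<rho> x"
  defines "\<rho>' \<equiv> subst_rule (\<lambda>v. Var (\<pi> v)) \<rho>" and "x' \<equiv> \<lambda>e. x (\<pi> -` e)"
  shows "fractional_cover \<rho>' x'" "(\<Sum>e \<in> hyperedges \<rho>'. x' e) = (\<Sum>e \<in> hyperedges \<rho>. x e)"
proof -
  have inj: "inj \<pi>" using assms(1) by (rule bij_is_inj)
  have vimage: "\<pi> -` \<pi> ` e = e" for e
    using inj by (rule inj_vimage_image_eq)
  have vars: "vars_atom (subst_atom (\<lambda>v. Var (\<pi> v)) a) = \<pi> ` vars_atom a" for a :: "('a, 'b) atom"
    by (auto simp: vars_atom_subst)
  have edges: "hyperedges \<rho>' = image \<pi> ` hyperedges \<rho>"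
    by (simp add: \<rho>'_def hyperedges_def image_image vars)
  have inj_image: "inj_on (image \<pi>) X" for X
    using inj by (auto simp: inj_on_def inj_image_eq_iff)
  show "(\<Sum>e \<in> hyperedges \<rho>'. x' e) = (\<Sum>e \<in> hyperedges \<rho>. x e)"
    by (simp add: edges sum.reindex[OF inj_image] x'_def vimage)
  show "fractional_cover \<rho>' x'"
    unfolding fractional_cover_def
  proof (intro conjI ballI)
    fix w assume "w \<in> vars_atom (hd_atom \<rho>')"
    then obtain v where v: "v \<in> vars_atom (hd_atom \<rho>)" "w = \<pi> v"
      by (auto simp: \<rho>'_def vars)
    have "{e \<in> hyperedges \<rho>'. w \<in> e} = image \<pi> ` {e \<in> hyperedges \<rho>. v \<in> e}"
      by (auto simp: edges v dest: injD[OF inj])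
    then have "(\<Sum>e \<in> {e \<in> hyperedges \<rho>'. w \<in> e}. x' e) = (\<Sum>e \<in> {e \<in> hyperedges \<rho>. v \<in> e}. x e)"
      by (simp add: sum.reindex[OF inj_image] x'_def vimage)
    then show "1 \<le> (\<Sum>e \<in> {e \<in> hyperedges \<rho>'. w \<in> e}. x' e)"
      using assms(2) v by (simp add: fractional_cover_def)
  qed (use assms(2) in \<open>auto simp: edges x'_def vimage fractional_cover_def\<close>)
qed

lemma ew_rule_variant:
  assumes "variant \<rho> \<rho>'"
  shows "ew_rule \<rho> = ew_rule \<rho>'"
proof -
  have "{\<Sum>e \<in> hyperedges \<rho>. x e | x. fractional_cover \<rho> x}
      \<subseteq> {\<Sum>e \<in> hyperedges \<rho>'. x e | x. fractional_cover \<rho>' x}"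
    if variant: "variant \<rho> \<rho>'" for \<rho> \<rho>' :: "('a, 'b) rule"
  proof
    fix s assume "s \<in> {\<Sum>e \<in> hyperedges \<rho>. x e | x. fractional_cover \<rho> x}"
    then obtain x where x: "s = (\<Sum>e \<in> hyperedges \<rho>. x e)" "fractional_cover \<rho> x"
      by blast
    obtain \<pi> where \<pi>: "bij \<pi>" "\<rho>' = subst_rule (\<lambda>v. Var (\<pi> v)) \<rho>"
      using variant by (auto simp: variant_def)
    show "s \<in> {\<Sum>e \<in> hyperedges \<rho>'. x e | x. fractional_cover \<rho>' x}"
      using fractional_cover_rename[OF \<pi>(1) x(2)] x(1) unfolding \<pi>(2)
      by (intro CollectI exI[of _ "\<lambda>e. x (\<pi> -` e)"]) simp
  qed
  then have "{\<Sum>e \<in> hyperedges \<rho>. x e | x. fractional_cover \<rho> x}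
      = {\<Sum>e \<in> hyperedges \<rho>'. x e | x. fractional_cover \<rho>' x}"
    using assms variant_sym by (intro subset_antisym) blast+
  then show ?thesis by (simp add: ew_rule_def)
qed

text \<open>The set under \<open>Max\<close> ranges over all representatives of an adornment. Its
  finiteness, without which \<open>Max\<close> would say nothing, comes from the width being
  constant on each class and from the finite number of classes.\<close>

lemma ew_rule_le_ew:
  assumes "finite P" "adorned q \<rho> \<in> adorned_preds q P"
  shows "ew_rule \<rho> \<le> ew q P"
proof -
  define w where "w A = ew_rule (SOME \<rho>. A = adorned q \<rho>)" for A :: "('a, 'b) apred"
  have w: "w (adorned q \<rho>) = ew_rule \<rho>" for \<rho>
    unfolding w_def by (metis (mono_tags) adorned_eq_iff ew_rule_variant someI)
  have "ew_rule \<rho> \<in> w ` adorned_preds q P" if "adorned q \<rho> \<in> adorned_preds q P" for \<rho>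
    using that by (metis w image_eqI)
  then have "{ew_rule \<rho> | \<rho>. adorned q \<rho> \<in> adorned_preds q P} \<subseteq> w ` adorned_preds q P"
    by blast
  moreover have "finite (adorned_preds q P)"
    using assms(1) by (auto simp: adorned_preds_def setcompr_eq_image)
  ultimately have "finite {ew_rule \<rho> | \<rho>. adorned q \<rho> \<in> adorned_preds q P}"
    by (meson finite_imageI finite_subset)
  then show ?thesis
    unfolding ew_def using assms(2) by (intro Max_ge) auto
qed

section \<open>Counting the answers of a single rule\<close>

lemma card_image_le_factor:
  assumes "finite T" "g ` X \<subseteq> T" "\<And>x y. x \<in> X \<Longrightarrow> y \<in> X \<Longrightarrow> g x = g y \<Longrightarrow> f x = f y"
  shows "finite (f ` X) \<and> card (f ` X) \<le> card T"
proof -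
  have "f x = f (inv_into X g (g x))" if "x \<in> X" for x
    using assms(3) that by (metis f_inv_into_f imageI inv_into_into)
  then have sub: "f ` X \<subseteq> (\<lambda>t. f (inv_into X g t)) ` T"
    using assms(2) by blast
  then show ?thesis
    using surj_card_le[OF assms(1) sub] finite_subset[OF sub] assms(1) by simp
qed

text \<open>Answers are determined by the valuation on the head variables, so they are counted by a
  projection. Conversely, the tuple matched by an atom determines the valuation on its hyperedge, so
  each factor of the product is at most \<open>N\<close>.\<close>

lemma card_answers_le_cover:
  fixes N :: nat
  assumes fin: "finite (body \<rho>)" and "safe \<rho>" and cov: "fractional_cover \<rho> x" and "1 \<le> N"
    and I: "\<And>a. a \<in> body \<rho> \<Longrightarrow> finite (I (fst a)) \<and> card (I (fst a)) \<le> N"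
  shows "finite (answers I \<rho>) \<and> real (card (answers I \<rho>)) \<le> real N powr (\<Sum>e \<in> hyperedges \<rho>. x e)"
proof -
  define X where "X = {\<theta>. \<forall>a\<in>body \<rho>. map (eval_trm \<theta>) (snd a) \<in> I (fst a)}"
  define W where "W = (\<Union>a\<in>body \<rho>. vars_atom a)"
  define V where "V = vars_atom (hd_atom \<rho>)"
  define C where "C = (\<Union>a\<in>body \<rho>. \<Union>t\<in>I (fst a). set t)"
  \<comment> \<open>Valuations are arbitrary outside the body variables, so \<open>X\<close> is
    infinite in general; cutting down to \<open>W\<close> leaves finitely many functions with values
    in \<open>C\<close>.\<close>
  define A where "A = proj W X"
  have VW: "V \<subseteq> W" using \<open>safe \<rho>\<close> by (simp add: safe_def V_def W_def)
  have "finite C" "finite W" using fin I by (auto simp: C_def W_def)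
  have "\<theta> v \<in> C" if \<theta>: "\<theta> \<in> X" and "v \<in> W" for \<theta> v
  proof -
    obtain a where a: "a \<in> body \<rho>" "Var v \<in> set (snd a)"
      using \<open>v \<in> W\<close> by (auto simp: W_def in_vars_atom_iff)
    then have "\<theta> v \<in> set (map (eval_trm \<theta>) (snd a))" by force
    moreover have "map (eval_trm \<theta>) (snd a) \<in> I (fst a)"
      using a \<theta> by (simp add: X_def)
    ultimately show ?thesis
      unfolding C_def using a by blast
  qed
  then have "A \<subseteq> {f. \<forall>v. (v \<in> W \<longrightarrow> f v \<in> C) \<and> (v \<notin> W \<longrightarrow> f v = undefined)}"
    by (auto simp: A_def proj_def restrict_def)
  then have "finite A"
    using finite_set_of_finite_funs[OF \<open>finite W\<close> \<open>finite C\<close>] finite_subset by blast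
  have projA: "proj Z A = (\<lambda>\<theta>. restrict \<theta> Z) ` X" if "Z \<subseteq> W" for Z
    unfolding A_def proj_def image_image using that
    by (intro image_cong refl) (auto simp: restrict_def fun_eq_iff)
  have "answers I \<rho> = (\<lambda>\<theta>. map (eval_trm \<theta>) (snd (hd_atom \<rho>))) ` X"
    by (auto simp: answers_def X_def)
  moreover have "finite ((\<lambda>\<theta>. map (eval_trm \<theta>) (snd (hd_atom \<rho>))) ` X) \<and>
      card ((\<lambda>\<theta>. map (eval_trm \<theta>) (snd (hd_atom \<rho>))) ` X) \<le> card (proj V A)"
  proof (rule card_image_le_factor)
    show "finite (proj V A)" using \<open>finite A\<close> by (rule finite_proj)
    show "(\<lambda>\<theta>. restrict \<theta> V) ` X \<subseteq> proj V A" by (simp add: projA VW)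
    show "map (eval_trm \<theta>) (snd (hd_atom \<rho>)) = map (eval_trm \<theta>') (snd (hd_atom \<rho>))"
      if "restrict \<theta> V = restrict \<theta>' V" for \<theta> \<theta>' :: "nat \<Rightarrow> 'b"
      using that by (intro map_eval_trm_cong) (metis V_def restrict_def)
  qed
  ultimately have ans: "finite (answers I \<rho>)" "card (answers I \<rho>) \<le> card (proj V A)"
    by auto
  have "real (card (proj V A)) \<le> (\<Prod>e\<in>hyperedges \<rho>. real (card (proj (e \<inter> V) A)) powr x e)"
    using cov \<open>finite A\<close> fin
    by (intro card_proj_le_prod) (auto simp: fractional_cover_def V_def hyperedges_def)
  also have "\<dots> \<le> (\<Prod>e\<in>hyperedges \<rho>. real N powr x e)"
  proof (intro prod_mono conjI powr_mono2)
    fix e assume e: "e \<in> hyperedges \<rho>"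
    then obtain a where a: "a \<in> body \<rho>" "e = vars_atom a"
      by (auto simp: hyperedges_def)
    have "card ((\<lambda>\<theta>. restrict \<theta> (e \<inter> V)) ` X) \<le> card (I (fst a))"
    proof (rule conjunct2[OF card_image_le_factor])
      show "(\<lambda>\<theta>. map (eval_trm \<theta>) (snd a)) ` X \<subseteq> I (fst a)"
        using a by (auto simp: X_def)
      fix \<theta> \<theta>' :: "nat \<Rightarrow> 'b"
      assume *: "map (eval_trm \<theta>) (snd a) = map (eval_trm \<theta>') (snd a)"
      have "\<theta> v = \<theta>' v" if "v \<in> e" for v
      proof -
        have "Var v \<in> set (snd a)" using that by (simp add: a in_vars_atom_iff)
        with * have "eval_trm \<theta> (Var v) = eval_trm \<theta>' (Var v)"
          unfolding map_eq_conv by (rule bspec)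
        then show ?thesis by simp
      qed
      then show "restrict \<theta> (e \<inter> V) = restrict \<theta>' (e \<inter> V)"
        by (auto simp: restrict_def)
    qed (use I[OF a(1)] in simp)
    then show "real (card (proj (e \<inter> V) A)) \<le> real N"
      using I[OF a(1)] VW by (subst projA) auto
    show "0 \<le> x e" using cov e by (simp add: fractional_cover_def)
  qed auto
  also have "\<dots> = real N powr (\<Sum>e\<in>hyperedges \<rho>. x e)"
    using \<open>1 \<le> N\<close> fin by (subst powr_sum) (auto simp: hyperedges_def)
  finally show ?thesis using ans by linarith
qed

text \<open>A witness that covers exist at all, so that the infimum in \<open>ew_rule\<close> is
  over a non-empty set.\<close>

lemma fractional_cover_one:
  assumes "finite (body \<rho>)" "safe \<rho>"
  shows "fractional_cover \<rho> (\<lambda>_. 1)"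
  unfolding fractional_cover_def
proof (intro conjI ballI)
  fix v assume "v \<in> vars_atom (hd_atom \<rho>)"
  then have "{e \<in> hyperedges \<rho>. v \<in> e} \<noteq> {}"
    using assms(2) by (auto simp: safe_def hyperedges_def)
  moreover have "finite {e \<in> hyperedges \<rho>. v \<in> e}"
    using assms(1) by (simp add: hyperedges_def)
  ultimately have "1 \<le> card {e \<in> hyperedges \<rho>. v \<in> e}"
    by (simp add: Suc_le_eq card_gt_0_iff)
  then show "1 \<le> (\<Sum>e \<in> {e \<in> hyperedges \<rho>. v \<in> e}. 1 :: real)"
    by simp
qed auto

text \<open>Taking logarithms to base \<open>N\<close> turns the bound for each cover into a lower
  bound for its weight, which then passes to the infimum.\<close>

lemma card_answers_le:
  fixes N :: nat
  assumes fin: "finite (body \<rho>)" "safe \<rho>" and N: "1 \<le> N"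
    and I: "\<And>a. a \<in> body \<rho> \<Longrightarrow> finite (I (fst a)) \<and> card (I (fst a)) \<le> N"
  shows "finite (answers I \<rho>)" "real (card (answers I \<rho>)) \<le> real N powr ew_rule \<rho>"
proof -
  note le = card_answers_le_cover[where I = I, OF fin _ N I]
  note cov = fractional_cover_one[OF fin]
  show "finite (answers I \<rho>)"
    using le[OF cov] by simp
  let ?n = "card (answers I \<rho>)"
  \<comment> \<open>The logarithm needs a positive argument and a base above 1; in the other two
    cases the bound is immediate.\<close>
  consider "?n = 0" | "N = 1" | "?n > 0" "N > 1" using N by linarith
  then show "real ?n \<le> real N powr ew_rule \<rho>"
  proof cases
    case 2
    then show ?thesis using le[OF cov] by simp
  next
    case 3
    have "log N ?n \<le> ew_rule \<rho>"
      unfolding ew_rule_def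
    proof (rule cInf_greatest)
      show "{\<Sum>e \<in> hyperedges \<rho>. x e | x. fractional_cover \<rho> x} \<noteq> {}"
        using cov by blast
      fix s assume "s \<in> {\<Sum>e \<in> hyperedges \<rho>. x e | x. fractional_cover \<rho> x}"
      then have "real ?n \<le> real N powr s"
        using le by blast
      then show "log N ?n \<le> s"
        using 3 by (simp add: log_le_iff)
    qed
    then show ?thesis using 3 by (simp add: log_le_iff)
  qed simp
qed

section \<open>The bound\<close>

text \<open>A rule with an EDB head has an empty body, and safety then makes it a ground fact, so
  each rule contributes at most one tuple. Finiteness must be known separately because
  \<open>card\<close> is 0 on infinite sets, where a bound on it carries no information.\<close>

lemma finite_rel_edb:
  assumes "datalog_program ar \<Pi>" "finite (D e)" "e \<notin> idb \<Pi>"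
  shows "finite (rel \<Pi> D e)"
proof -
  have "t \<in> D e \<union> (\<lambda>R. map (eval_trm (\<lambda>_. undefined)) (snd (hd_atom R))) ` \<Pi>"
    if "derivable \<Pi> D e t" for t
    using that
  proof cases
    case (from_rule R \<theta>)
    then have "body R = {}" using assms(3) by (auto simp: idb_def)
    then have "vars_atom (hd_atom R) = {}"
      using assms(1) from_rule by (auto simp: datalog_program_def safe_def)
    then have "t = map (eval_trm (\<lambda>_. undefined)) (snd (hd_atom R))"
      using from_rule by (simp only:) (rule map_eval_trm_cong, simp)
    then show ?thesis using from_rule by blast
  qed auto
  then have "rel \<Pi> D e \<subseteq> D e \<union> (\<lambda>R. map (eval_trm (\<lambda>_. undefined)) (snd (hd_atom R))) ` \<Pi>"
    by (auto simp: rel_def)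
  moreover have "finite \<Pi>" using assms(1) by (simp add: datalog_program_def)
  ultimately show ?thesis using assms(2) by (meson finite_UnI finite_imageI finite_subset)
qed

lemma not_derivable:
  assumes "\<And>p. D p = {}" "\<And>R. R \<in> \<Pi> \<Longrightarrow> body R \<noteq> {}"
  shows "\<not> derivable \<Pi> D p t"
proof
  assume "derivable \<Pi> D p t"
  then show False
  proof (induction rule: derivable.induct)
    case (from_rule R \<theta>)
    then show ?case using assms(2) by blast
  qed (simp add: assms(1))
qed

theorem proposition5p10:
  fixes ar :: "'p \<Rightarrow> nat" and \<Pi> :: "('p, 'c) program" and \<Pi>' :: "('p, 'c) aprogram"
    and D :: "'p \<Rightarrow> 'c list set" and q :: 'p and N :: nat
  assumes "datalog_program ar \<Pi>"
    and "q \<in> idb \<Pi>"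
    and "adornment_output g_out h_eq \<Pi> \<Pi>'"
    and "edb_instance ar \<Pi> D"
    and "\<And>e. e \<notin> idb \<Pi> \<Longrightarrow> card (rel \<Pi> D e) \<le> N"
    and "N \<ge> 1 \<or> (\<forall>R \<in> \<Pi>. body R \<noteq> {})"
  shows "real (card (rel \<Pi> D q)) \<le> real (card (adorned_preds q \<Pi>')) * real N powr ew q \<Pi>'"
proof -
  have D: "\<And>p. finite (D p)" "\<And>p. p \<in> idb \<Pi> \<Longrightarrow> D p = {}"
    using assms(4) by (auto simp: edb_instance_def)
  have fin: "finite (rel \<Pi> D e)" if "e \<notin> idb \<Pi>" for e
    using finite_rel_edb[OF assms(1) D(1) that] .
  show ?thesis
  proof (cases "N = 0")
    \<comment> \<open>The right-hand side is 0, so \<open>q\<close> must be empty. All EDB relations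
      are empty, and with no bodiless rules a derivation has nothing to start from.\<close>
    case True
    have "D p = {}" for p
    proof (cases "p \<in> idb \<Pi>")
      case False
      then have "rel \<Pi> D p = {}" using fin assms(5) True by fastforce
      then show ?thesis by (auto simp: rel_def intro: from_edb)
    qed (rule D(2))
    then have "rel \<Pi> D q = {}"
      using not_derivable[of D \<Pi>] assms(6) True by (auto simp: rel_def)
    then show ?thesis by simp
  next
    case False
    then have N: "1 \<le> N" by simp
    have steps: "(adorn_step g_out h_eq \<Pi>)\<^sup>*\<^sup>* {} \<Pi>'"
      using assms(3) by (simp add: adornment_output_def)
    have good: "edb_rule \<Pi> \<rho>" if "S \<in> \<Pi>'" "fst (hd_atom S) = adorned p \<rho>" for S p \<rho>
      using adorn_steps_edb_rule[OF steps assms(1)] that by blast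
    let ?A = "adorned_preds q \<Pi>'"
    have "finite \<Pi>'" using adorn_steps_edb_rule[OF steps assms(1)] by blast
    then have finA: "finite ?A"
      by (simp add: adorned_preds_def setcompr_eq_image)
    have "\<exists>\<rho>. A = adorned q \<rho>" if "A \<in> ?A" for A
      using that by (auto simp: adorned_preds_def)
    then obtain r where r: "\<And>A. A \<in> ?A \<Longrightarrow> A = adorned q (r A)"
      by metis
    have bound: "finite (answers (rel \<Pi> D) (r A))"
      "real (card (answers (rel \<Pi> D) (r A))) \<le> real N powr ew q \<Pi>'" if A: "A \<in> ?A" for A
    proof -
      obtain S where "S \<in> \<Pi>'" "fst (hd_atom S) = adorned q (r A)"
        using A r[OF A] by (auto simp: adorned_preds_def)
      then have edb: "edb_rule \<Pi> (r A)" by (rule good)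
      then have rels: "finite (rel \<Pi> D (fst a)) \<and> card (rel \<Pi> D (fst a)) \<le> N" if "a \<in> body (r A)" for a
        using that fin assms(5) by (auto simp: edb_rule_def)
      show "finite (answers (rel \<Pi> D) (r A))"
        using edb rels N by (intro card_answers_le) (auto simp: edb_rule_def)
      have "real (card (answers (rel \<Pi> D) (r A))) \<le> real N powr ew_rule (r A)"
        using edb rels N by (intro card_answers_le) (auto simp: edb_rule_def)
      also have "\<dots> \<le> real N powr ew q \<Pi>'"
        using N A r[OF A] \<open>finite \<Pi>'\<close> by (intro powr_mono ew_rule_le_ew) auto
      finally show "real (card (answers (rel \<Pi> D) (r A))) \<le> real N powr ew q \<Pi>'" .
    qed
    have "rel \<Pi> D q \<subseteq> (\<Union>A\<in>?A. answers (rel \<Pi> D) (r A))"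
    proof
      fix t assume "t \<in> rel \<Pi> D q"
      then have "derivable \<Pi> D q t" by (simp add: rel_def)
      from derivable_adorned[OF assms(1,3) D(2) this assms(2)]
      obtain S \<rho> where S: "S \<in> \<Pi>'" "fst (hd_atom S) = adorned q \<rho>" "t \<in> answers (rel \<Pi> D) \<rho>"
        by blast
      then have A: "adorned q \<rho> \<in> ?A"
        unfolding adorned_preds_def by (metis (mono_tags, lifting) CollectI IntI rangeI)
      then have "variant \<rho> (r (adorned q \<rho>))"
        using r adorned_eq_iff by metis
      then show "t \<in> (\<Union>A\<in>?A. answers (rel \<Pi> D) (r A))"
        using A S(3) answers_variant by blast
    qed
    then have "card (rel \<Pi> D q) \<le> card (\<Union>A\<in>?A. answers (rel \<Pi> D) (r A))"
      using finA bound(1) by (intro card_mono) auto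
    \<comment> \<open>The union has one member per adornment of \<open>q\<close>; this is the origin
      of the factor \<open>card (adorned_preds q \<Pi>')\<close>.\<close>
    also have "\<dots> \<le> (\<Sum>A\<in>?A. card (answers (rel \<Pi> D) (r A)))"
      using finA by (rule card_UN_le)
    finally have "real (card (rel \<Pi> D q)) \<le> (\<Sum>A\<in>?A. real (card (answers (rel \<Pi> D) (r A))))"
      by (simp flip: of_nat_sum)
    also have "\<dots> \<le> (\<Sum>A\<in>?A. real N powr ew q \<Pi>')"
      using bound(2) by (rule sum_mono)
    finally show ?thesis by simp
  qed
qed

end
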